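(* Consider the family of all cubic (3-regular) simple graphs on $10$ vertices, taken up to isomorphism (there are exactly $21$ of them). Then: (1) Exactly six graphs of this family are not $\mathcal{E}$-unique (equivalently, not $\mathcal{RE}$-unique) within the family; that is, exactly six graphs in the family have the same energy (equivalently, the same Randić energy) as some other, non-isomorphic graph of the family. (2) If two non-isomorphic cubic graphs $G, H$ of order $10$ satisfy $E(G)=E(H)$ (equivalently $RE(G)=RE(H)$), then their adjacency spectra differ in exactly $3$ values: after removing from the multiset of eigenvalues of $G$ and the multiset of eigenvalues of $H$ their common part (multiset intersection), exactly $3$ eigenvalues remain in each.
   Context: All graphs are finite, simple, undirected, without loops. For a graph $G$ with adjacency matrix $A(G)$ having eigenvalues $\lambda_1,\dots,\lambda_n$ (counted with multiplicity), the energy is $E(G)=\sum_{i=1}^n|\lambda_i|$. The Randić matrix $R(G)$ has $(i,j)$-entry $1/\sqrt{d_id_j}$ if $v_i\sim v_j$ and $0$ otherwise, where $d_i$ is the degree of $v_i$; the Randić energy $RE(G)$ is the sum of the absolute values of the eigenvalues of $R(G)$. A graph $G$ in a family $\mathcal{F}$ is $\mathcal{E}$-unique (resp. $\mathcal{RE}$-unique) in $\mathcal{F}$ if no graph of $\mathcal{F}$ non-isomorphic to $G$ has the same energy (resp. Randić energy) as $G$. *)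

theory Defs
  imports
    "HOL-Analysis.Analysis"
    "Graph_Theory.Graph_Theory"
    "Jordan_Normal_Form.Char_Poly"
begin

text \<open>
  A finite simple undirected graph is a \<^locale>\<open>pair_graph\<close>: a finite vertex set together with
  a symmetric, loop-free set of ordered pairs of vertices. Every undirected edge is present as two
  arcs, so the degree of a vertex is its \<^const>\<open>out_degree\<close>, and \<^const>\<open>digraph_iso\<close> (on the
  underlying digraphs) is the usual isomorphism of simple graphs.
\<close>

definition degree_of :: "'a pair_pre_digraph \<Rightarrow> 'a \<Rightarrow> nat" where
  "degree_of G v = out_degree (with_proj G) v"

definition isomorphic :: "'a pair_pre_digraph \<Rightarrow> 'b pair_pre_digraph \<Rightarrow> bool" where
  "isomorphic G H \<longleftrightarrow> digraph_iso (with_proj G) (with_proj H)"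

definition cubic_graphs :: "nat \<Rightarrow> 'a pair_pre_digraph set" where
  "cubic_graphs n =
     {G. pair_graph G \<and> card (pverts G) = n \<and> (\<forall>v\<in>pverts G. degree_of G v = 3)}"

text \<open>Being isomorphic, as a relation on a family of graphs, so that \<open>F' // iso_rel F\<close>
  for \<open>F' \<subseteq> F\<close> consists of the isomorphism classes of the members of \<open>F'\<close>
  (provided that \<open>F'\<close> is closed under isomorphism within \<open>F\<close>).\<close>

definition iso_rel :: "'a pair_pre_digraph set \<Rightarrow> 'a pair_pre_digraph rel" where
  "iso_rel F = {(G, H). G \<in> F \<and> H \<in> F \<and> isomorphic G H}"

text \<open>A listing \<open>v\<^sub>1, \<dots>, v\<^sub>n\<close> of the vertices, used to index the rows and columns of matrices.
  Another listing conjugates these matrices by a permutation matrix, so the eigenvalues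
  do not depend on the choice.\<close>

definition vertex_list :: "'a pair_pre_digraph \<Rightarrow> 'a list" where
  "vertex_list G = (SOME vs. distinct vs \<and> set vs = pverts G)"

definition adjacency_matrix :: "'a pair_pre_digraph \<Rightarrow> real mat" where
  "adjacency_matrix G =
     (let vs = vertex_list G; n = card (pverts G) in
      mat n n (\<lambda>(i, j). if (vs ! i, vs ! j) \<in> parcs G then 1 else 0))"

definition randic_matrix :: "'a pair_pre_digraph \<Rightarrow> real mat" where
  "randic_matrix G =
     (let vs = vertex_list G; n = card (pverts G) in
      mat n n (\<lambda>(i, j). if (vs ! i, vs ! j) \<in> parcs G
        then 1 / sqrt (real (degree_of G (vs ! i)) * real (degree_of G (vs ! j))) else 0))"

text \<open>The real eigenvalues with algebraic multiplicity. It is applied only to symmetric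
  matrices, whose characteristic polynomials split over the reals, so no eigenvalue is lost.\<close>

definition eigenvalues :: "real mat \<Rightarrow> real multiset" where
  "eigenvalues A = proots (char_poly A)"

definition adjacency_spectrum :: "'a pair_pre_digraph \<Rightarrow> real multiset" where
  "adjacency_spectrum G = eigenvalues (adjacency_matrix G)"

definition energy :: "'a pair_pre_digraph \<Rightarrow> real" where
  "energy G = (\<Sum>x\<in>#adjacency_spectrum G. \<bar>x\<bar>)"

definition randic_energy :: "'a pair_pre_digraph \<Rightarrow> real" where
  "randic_energy G = (\<Sum>x\<in>#eigenvalues (randic_matrix G). \<bar>x\<bar>)"

text \<open>\<open>unique_in f F G\<close> is uniqueness of \<open>G\<close> in the family \<open>F\<close> with respect to the graph
  invariant \<open>f\<close>; \<open>f\<close> is instantiated with \<^const>\<open>energy\<close> and \<^const>\<open>randic_energy\<close>.\<close>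

definition unique_in ::
    "('a pair_pre_digraph \<Rightarrow> real) \<Rightarrow> 'a pair_pre_digraph set \<Rightarrow> 'a pair_pre_digraph \<Rightarrow> bool" where
  "unique_in f F G \<longleftrightarrow> \<not> (\<exists>H\<in>F. \<not> isomorphic G H \<and> f H = f G)"

end

theory Submission
  imports Defs
begin

text \<open>
  A breadth-first numbering of the vertices turns a cubic graph of order 10 into one of 649 labelled
  graphs, and an explicit relabelling identifies each of these with one of 21 representatives. The
  characteristic polynomials of the representatives are certified by the Faddeev-LeVerrier recursion
  and factored over the integers, and sign changes isolate the roots well enough to separate all energies
  except for three coincidences. In each of these the two spectra have the form \<open>C + D\<close> and \<open>C + (- D)\<close>
  with \<open>D\<close> of size 3 and disjoint from \<open>- D\<close>, so that the energies agree. Since every degree is 3, the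
  Randic matrix is a third of the adjacency matrix, so both energies make the same distinctions.
\<close>

section \<open>Characteristic polynomials\<close>

text \<open>The statement speaks of graphs over arbitrary vertex types and of matrices indexed by an
  arbitrarily chosen vertex listing. The relation \<open>realises\<close> removes both: it ties a
  graph to an adjacency list over numbers, where all computation takes place. Non-isomorphism of the
  representatives is read off their spectra. Equal spectra would force equal energies, and in the
  three coincidences the spectra visibly differ; hence the bounds that separate the energies also
  show that there are exactly 21 classes. Characteristic polynomials are not computed from the
  matrices but verified from a claimed factorisation. That all eigenvalues are real follows from
  counting sign changes of the factors instead of from the spectral theorem. Approximation can
  separate energies but never prove two of them equal, so the coincidences use exact spectra:
  integers and the roots of \<open>x^2 + x - 4\<close> and \<open>x^2 - x - 4\<close>.\<close>

lemma char_poly_permute: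
  fixes A :: "'a :: comm_ring_1 mat"
  assumes A: "A \<in> carrier_mat n n" and p: "p permutes {0..<n}"
  shows "char_poly (mat n n (\<lambda>(i, j). A $$ (p i, p j))) = char_poly A"
proof -
  let ?X = "char_poly_matrix A"
  let ?Y = "mat n n (\<lambda>(i, j). ?X $$ (i, p j))"
  have X: "?X \<in> carrier_mat n n" using A by simp
  have lt: "p i < n" if "i < n" for i using permutes_in_image[OF p, of i] that by simp
  have inj: "p i = p j \<longleftrightarrow> i = j" for i j using permutes_inj[OF p] by (auto dest: injD)
  have "char_poly_matrix (mat n n (\<lambda>(i, j). A $$ (p i, p j))) = mat n n (\<lambda>(i, j). ?Y $$ (p i, j))"
    using A by (intro eq_matI) (auto simp: char_poly_matrix_def lt inj)
  then have "char_poly (mat n n (\<lambda>(i, j). A $$ (p i, p j))) = signof p * det ?Y"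
    unfolding char_poly_def by (simp add: det_permute_rows[of ?Y n p, OF _ p])
  \<comment> \<open>Transposing turns the permuted columns into permuted rows; the two equal signs
    then multiply to 1.\<close>
  also have "det ?Y = det (transpose_mat ?Y)" by (rule det_transpose[symmetric, of _ n]) simp
  also have "transpose_mat ?Y = mat n n (\<lambda>(i, j). transpose_mat ?X $$ (p i, j))"
    using A by (intro eq_matI) (auto simp: lt char_poly_matrix_def)
  also have "det \<dots> = signof p * det ?X"
    using det_permute_rows[of "transpose_mat ?X" n p] X p det_transpose[OF X] by simp
  finally show ?thesis by (simp add: char_poly_def sign_def mult.assoc[symmetric] split: if_splits)
qed

text \<open>The difference \<open>d = p - q\<close> satisfies \<open>q d' = d q'\<close> and has
  degree below \<open>n\<close>. Comparing leading coefficients gives \<open>degree d = n\<close>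
  unless \<open>d = 0\<close>.\<close>

lemma monic_eq_of_pderiv:
  fixes p q :: "real poly"
  assumes p: "lead_coeff p = 1" "degree p = n" and q: "lead_coeff q = 1" "degree q = n"
    and eq: "q * pderiv p = p * pderiv q"
  shows "p = q"
proof (rule ccontr)
  define d where "d = p - q"
  assume "p \<noteq> q"
  then have d0: "d \<noteq> 0" by (simp add: d_def)
  have "coeff d n = 0" using p q by (simp add: d_def)
  then have dn: "degree d < n"
    using d0 p q by (metis coeff_0 d_def degree_diff_le eq_zero_or_degree_less le_refl leading_coeff_0_iff)
  have e: "q * pderiv d = d * pderiv q"
    using eq by (simp add: d_def pderiv_diff algebra_simps)
  have lead: "lead_coeff (pderiv r) = of_nat (degree r) * lead_coeff r" for r :: "real poly"
    by (cases "degree r") (auto simp: degree_pderiv coeff_pderiv pderiv_eq_0_iff coeff_eq_0)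
  have "lead_coeff (q * pderiv d) = lead_coeff (d * pderiv q)" using e by simp
  then have "of_nat (degree d) * lead_coeff d = of_nat n * lead_coeff d"
    using q by (simp add: lead_coeff_mult lead)
  then show False using d0 dn by simp
qed

lemma poly_char_poly:
  fixes M :: "'a :: field mat"
  assumes "M \<in> carrier_mat n n"
  shows "poly (char_poly M) x = det (x \<cdot>\<^sub>m 1\<^sub>m n - M)"
  unfolding char_poly_matrix[OF assms]
  by (rule arg_cong[where f = det], rule eq_matI) (use assms in \<open>auto simp: char_matrix_def\<close>)

text \<open>A right inverse of \<open>xI - A\<close> up to the factor \<open>q x\<close> is proportional to the adjugate, whose trace
  is \<open>p'\<close> for \<open>p\<close> the characteristic polynomial; comparing traces gives \<open>q p' = p q'\<close>.\<close>

lemma char_poly_eqI: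
  fixes A :: "real mat"
  assumes A: "A \<in> carrier_mat n n" and q: "lead_coeff q = 1" "degree q = n"
    and B: "\<And>x. B x \<in> carrier_mat n n"
    and inv: "\<And>x. (x \<cdot>\<^sub>m 1\<^sub>m n - A) * B x = poly q x \<cdot>\<^sub>m 1\<^sub>m n"
    and tr: "\<And>x. (\<Sum>i<n. B x $$ (i, i)) = poly (pderiv q) x"
  shows "char_poly A = q"
proof (rule monic_eq_of_pderiv)
  show "lead_coeff (char_poly A) = 1" "degree (char_poly A) = n"
    using degree_monic_char_poly[OF A] by auto
  show "q * pderiv (char_poly A) = char_poly A * pderiv q"
  proof (rule poly_eq_poly_eq_iff[THEN iffD1], rule ext)
    fix x
    let ?C = "x \<cdot>\<^sub>m 1\<^sub>m n - A"
    have C: "?C \<in> carrier_mat n n" using A by (rule minus_carrier_mat)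
    \<comment> \<open>The diagonal cofactors of \<open>xI - A\<close> are thus characteristic
      polynomials of principal submatrices, and these sum to the derivative of the characteristic
      polynomial of \<open>A\<close>.\<close>
    have del: "mat_delete ?C i i = x \<cdot>\<^sub>m 1\<^sub>m (n - 1) - mat_delete A i i" if "i < n" for i
      using A that by (intro eq_matI) (auto simp: mat_delete_def)
    have "(\<Sum>i<n. adj_mat ?C $$ (i, i)) = (\<Sum>i<n. poly (char_poly (mat_delete A i i)) x)"
    proof (rule sum.cong[OF refl])
      fix i assume "i \<in> {..<n}"
      then have i: "i < n" by simp
      have "mat_delete A i i \<in> carrier_mat (n - 1) (n - 1)" using A by (auto simp: mat_delete_def)
      then show "adj_mat ?C $$ (i, i) = poly (char_poly (mat_delete A i i)) x"
        using A i by (simp add: adj_mat_def cofactor_def poly_char_poly del)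
    qed
    also have "\<dots> = poly (pderiv (char_poly A)) x"
      by (simp add: pderiv_char_poly[OF A] poly_sum)
    finally have tra: "(\<Sum>i<n. adj_mat ?C $$ (i, i)) = poly (pderiv (char_poly A)) x" .
    note adj = adj_mat[OF C]
    \<comment> \<open>Bracketing \<open>adj C * C * B x\<close> in both ways avoids dividing by
      \<open>det C\<close>, so eigenvalues \<open>x\<close> are covered as well.\<close>
    have "poly q x \<cdot>\<^sub>m adj_mat ?C = adj_mat ?C * (?C * B x)"
      using right_mult_one_mat[OF adj(1)]
      by (simp add: inv mult_smult_distrib[OF adj(1) one_carrier_mat])
    also have "\<dots> = adj_mat ?C * ?C * B x" by (rule assoc_mult_mat[symmetric, OF adj(1) C B])
    also have "\<dots> = det ?C \<cdot>\<^sub>m B x"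
      using B[of x] by (simp add: adj(3) mult_smult_assoc_mat[of _ n n])
    finally have "(\<Sum>i<n. (poly q x \<cdot>\<^sub>m adj_mat ?C) $$ (i, i)) = (\<Sum>i<n. (det ?C \<cdot>\<^sub>m B x) $$ (i, i))"
      by simp
    then have "poly q x * poly (pderiv (char_poly A)) x = det ?C * poly (pderiv q) x"
      using adj(1) B[of x] C by (simp add: tra[symmetric] tr[symmetric] sum_distrib_left)
    then show "poly (q * pderiv (char_poly A)) x = poly (char_poly A * pderiv q) x"
      by (simp add: poly_char_poly[OF A])
  qed
qed (use q in auto)

section \<open>Verification of characteristic polynomials by the Faddeev-LeVerrier recursion\<close>

definition wf_rows :: "nat list list \<Rightarrow> bool" where
  "wf_rows L \<longleftrightarrow> (\<forall>r\<in>set L. distinct r \<and> set r \<subseteq> {..<length L})"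

definition rows_matrix :: "nat list list \<Rightarrow> real mat" where
  "rows_matrix L = mat (length L) (length L) (\<lambda>(i, j). if j \<in> set (L ! i) then 1 else 0)"

fun add_row :: "int list \<Rightarrow> int list \<Rightarrow> int list" where
  "add_row (x # xs) (y # ys) = (x + y) # add_row xs ys"
| "add_row _ _ = []"

fun sum_rows :: "int list list \<Rightarrow> int list \<Rightarrow> nat list \<Rightarrow> int list" where
  "sum_rows M acc [] = acc"
| "sum_rows M acc (j # r) = sum_rows M (add_row (M ! j) acc) r"

text \<open>This is \<open>A M + c I\<close>, row by row, for the 0/1 matrix \<open>A\<close> with
  neighbour lists \<open>R\<close>: each row of \<open>A M\<close> is a sum of rows of
  \<open>M\<close>. The counter \<open>i\<close> is the row number, at which \<open>c\<close> enters
  the diagonal.\<close>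

fun mult_shift :: "nat \<Rightarrow> int list list \<Rightarrow> int \<Rightarrow> nat \<Rightarrow> nat list list \<Rightarrow> int list list" where
  "mult_shift n M c i [] = []"
| "mult_shift n M c i (r # R) = sum_rows M ((replicate n 0)[i := c]) r # mult_shift n M c (Suc i) R"

fun trace_from :: "nat \<Rightarrow> int list list \<Rightarrow> int" where
  "trace_from i [] = 0"
| "trace_from i (r # M) = r ! i + trace_from (Suc i) M"

text \<open>Faddeev-LeVerrier: from \<open>M\<^sub>1 = I\<close> and \<open>M\<^sub>k\<^sub>+\<^sub>1 = A M\<^sub>k + c\<^sub>n\<^sub>-\<^sub>k I\<close> one gets
  \<open>(xI - A) (x\<^sup>n\<^sup>-\<^sup>1 M\<^sub>1 + \<dots> + M\<^sub>n) = (x\<^sup>n + \<dots> + c\<^sub>0) I\<close> once \<open>M\<^sub>n\<^sub>+\<^sub>1 = 0\<close>; the trace conditions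
  say that the trace of the second factor is the derivative of the right-hand side. The last argument
  lists the coefficients below the current one \<open>c\<close>, highest degree first.\<close>

fun leverrier :: "nat list list \<Rightarrow> int \<Rightarrow> int list list \<Rightarrow> int list \<Rightarrow> bool" where
  "leverrier L c M [] = (M = replicate (length L) (replicate (length L) 0))"
| "leverrier L c M (c' # cs) = (trace_from 0 M = int (Suc (length cs)) * c \<and>
     leverrier L c' (mult_shift (length L) M c' 0 L) cs)"

definition int_mat :: "nat \<Rightarrow> int list list \<Rightarrow> real mat" where
  "int_mat n M = mat n n (\<lambda>(i, j). real_of_int (M ! i ! j))"

lemma int_mat_carrier [simp]: "int_mat n M \<in> carrier_mat n n"
  by (simp add: int_mat_def)

lemma add_row_nth: "length xs = length ys \<Longrightarrow> length (add_row xs ys) = length ys \<and>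
    (\<forall>j<length ys. add_row xs ys ! j = xs ! j + ys ! j)"
  by (induction xs ys rule: list_induct2) (auto simp: nth_Cons split: nat.splits)

lemma sum_rows_nth:
  assumes "\<forall>j\<in>set r. length (M ! j) = length acc"
  shows "length (sum_rows M acc r) = length acc \<and>
    (\<forall>j<length acc. sum_rows M acc r ! j = acc ! j + (\<Sum>k\<leftarrow>r. M ! k ! j))"
  using assms by (induction r arbitrary: acc) (auto simp: add_row_nth)

lemma mult_shift_nth:
  assumes "\<forall>r\<in>set R. \<forall>j\<in>set r. length (M ! j) = n"
  shows "length (mult_shift n M c i R) = length R \<and>
    (\<forall>k<length R. length (mult_shift n M c i R ! k) = n \<and> (\<forall>j<n. mult_shift n M c i R ! k ! j =
      (if j = i + k then c else 0) + (\<Sum>l\<leftarrow>R ! k. M ! l ! j)))"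
  using assms
proof (induction R arbitrary: i)
  case (Cons r R)
  have 1: "length (sum_rows M ((replicate n 0)[i := c]) r) = n"
    "j < n \<Longrightarrow> sum_rows M ((replicate n 0)[i := c]) r ! j = (if j = i then c else 0) + (\<Sum>k\<leftarrow>r. M ! k ! j)" for j
    using sum_rows_nth[of r M "(replicate n 0)[i := c]"] Cons.prems by (auto simp: nth_list_update)
  show ?case using Cons.IH[of "Suc i"] Cons.prems 1 by (auto simp: nth_Cons split: nat.splits)
qed simp

lemma trace_from_eq: "trace_from i M = (\<Sum>k<length M. M ! k ! (i + k))"
  by (induction M arbitrary: i) (simp_all add: sum.lessThan_Suc_shift del: sum.lessThan_Suc)

definition square_rows :: "nat \<Rightarrow> int list list \<Rightarrow> bool" where
  "square_rows n M \<longleftrightarrow> length M = n \<and> (\<forall>r\<in>set M. length r = n)"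

lemma mult_shift_mat:
  assumes L: "wf_rows L" "length L = n" and M: "square_rows n M"
  shows "square_rows n (mult_shift n M c 0 L)"
    and "int_mat n (mult_shift n M c 0 L) = rows_matrix L * int_mat n M + real_of_int c \<cdot>\<^sub>m 1\<^sub>m n"
proof -
  have len: "\<forall>r\<in>set L. \<forall>j\<in>set r. length (M ! j) = n"
    using L M by (auto simp: wf_rows_def square_rows_def subset_iff)
  note ms = mult_shift_nth[OF len, of c 0]
  show "square_rows n (mult_shift n M c 0 L)"
    using ms L by (auto simp: square_rows_def in_set_conv_nth)
  show "int_mat n (mult_shift n M c 0 L) = rows_matrix L * int_mat n M + real_of_int c \<cdot>\<^sub>m 1\<^sub>m n"
  proof (rule eq_matI)
    fix i j assume "i < dim_row (rows_matrix L * int_mat n M + real_of_int c \<cdot>\<^sub>m 1\<^sub>m n)"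
      "j < dim_col (rows_matrix L * int_mat n M + real_of_int c \<cdot>\<^sub>m 1\<^sub>m n)"
    then have ij: "i < n" "j < n" by (auto simp: int_mat_def)
    have row: "distinct (L ! i)" "set (L ! i) \<subseteq> {..<n}" using L ij by (auto simp: wf_rows_def)
    have "(\<Sum>l\<leftarrow>L ! i. real_of_int (M ! l ! j)) = (\<Sum>l\<in>set (L ! i). real_of_int (M ! l ! j))"
      using row by (simp add: sum_list_distinct_conv_sum_set)
    also have "\<dots> = (\<Sum>l\<in>{0..<n}. if l \<in> set (L ! i) then real_of_int (M ! l ! j) else 0)"
      using row by (intro sum.mono_neutral_cong_left) auto
    also have "\<dots> = (rows_matrix L * int_mat n M) $$ (i, j)"
      using ij L by (auto simp: rows_matrix_def int_mat_def scalar_prod_def intro!: sum.cong)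
    finally have s: "(\<Sum>l\<leftarrow>L ! i. real_of_int (M ! l ! j)) = (rows_matrix L * int_mat n M) $$ (i, j)" .
    have "int_mat n (mult_shift n M c 0 L) $$ (i, j) =
        (if j = i then real_of_int c else 0) + (\<Sum>l\<leftarrow>L ! i. real_of_int (M ! l ! j))"
      using ms ij L by (simp add: int_mat_def sum_list_of_int[symmetric] o_def)
    then show "int_mat n (mult_shift n M c 0 L) $$ (i, j)
        = (rows_matrix L * int_mat n M + real_of_int c \<cdot>\<^sub>m 1\<^sub>m n) $$ (i, j)"
      using ij L by (auto simp: s rows_matrix_def int_mat_def)
  qed (use L in \<open>auto simp: int_mat_def rows_matrix_def\<close>)
qed

text \<open>Invariant of a Horner scheme in \<open>x\<close>: \<open>q\<close> is the value of the
  coefficients read so far and \<open>B\<close> the matrix collected so far, with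
  \<open>(xI - A) B = q I - M\<close>. Passing to \<open>x B + M\<close> gives
  \<open>(x q + c') I - M'\<close> for \<open>M' = A M + c' I\<close>. The trace condition on
  \<open>M\<close> supplies the next coefficient of the derivative.\<close>

lemma leverrier_sound:
  assumes L: "wf_rows L" "length L = n"
    and "square_rows n M" "leverrier L c M cs" "B \<in> carrier_mat n n"
    and "(x \<cdot>\<^sub>m 1\<^sub>m n - rows_matrix L) * B = q \<cdot>\<^sub>m 1\<^sub>m n - int_mat n M"
  shows "\<exists>B'. B' \<in> carrier_mat n n \<and>
     (x \<cdot>\<^sub>m 1\<^sub>m n - rows_matrix L) * B' =
        (x ^ length cs * q + poly (Poly (map real_of_int (rev cs))) x) \<cdot>\<^sub>m 1\<^sub>m n \<and>
     (\<Sum>i<n. B' $$ (i, i)) = x ^ length cs * (\<Sum>i<n. B $$ (i, i)) +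
        poly (pderiv (Poly (map real_of_int (rev (c # cs))))) x"
  using assms(3-)
proof (induction cs arbitrary: c M B q)
  case Nil
  have "int_mat n M = 0\<^sub>m n n" using Nil L by (auto simp: int_mat_def intro!: eq_matI)
  then show ?case using Nil by (intro exI[of _ B]) (auto simp: pderiv_pCons)
next
  case (Cons c' cs)
  let ?A = "rows_matrix L"
  let ?M' = "mult_shift n M c' 0 L"
  let ?B' = "x \<cdot>\<^sub>m B + int_mat n M"
  have A: "?A \<in> carrier_mat n n" using L by (simp add: rows_matrix_def)
  note ms = mult_shift_mat[OF L Cons.prems(1), of c']
  have tr: "trace_from 0 M = int (Suc (length cs)) * c" and lev: "leverrier L c' ?M' cs"
    using Cons.prems(2) L by auto
  have C: "x \<cdot>\<^sub>m 1\<^sub>m n - ?A \<in> carrier_mat n n" using A by (rule minus_carrier_mat)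
  have "(x \<cdot>\<^sub>m 1\<^sub>m n - ?A) * ?B' =
      x \<cdot>\<^sub>m ((x \<cdot>\<^sub>m 1\<^sub>m n - ?A) * B) + (x \<cdot>\<^sub>m 1\<^sub>m n - ?A) * int_mat n M"
    using mult_add_distrib_mat[OF C, of "x \<cdot>\<^sub>m B" n "int_mat n M"] Cons.prems(3) mult_smult_distrib[OF C Cons.prems(3)]
    by simp
  also have "(x \<cdot>\<^sub>m 1\<^sub>m n - ?A) * int_mat n M = x \<cdot>\<^sub>m int_mat n M - ?A * int_mat n M"
    using minus_mult_distrib_mat[of "x \<cdot>\<^sub>m 1\<^sub>m n" n n ?A "int_mat n M" n] A
      mult_smult_assoc_mat[of "1\<^sub>m n" n n "int_mat n M" n x]
    by (simp add: left_mult_one_mat[of _ n n])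
  also have "x \<cdot>\<^sub>m ((x \<cdot>\<^sub>m 1\<^sub>m n - ?A) * B) + (x \<cdot>\<^sub>m int_mat n M - ?A * int_mat n M)
      = (x * q + real_of_int c') \<cdot>\<^sub>m 1\<^sub>m n - int_mat n ?M'"
    unfolding Cons.prems(4) ms(2)
    by (rule eq_matI) (use A in \<open>auto simp: int_mat_def algebra_simps\<close>)
  finally have step: "(x \<cdot>\<^sub>m 1\<^sub>m n - ?A) * ?B' = (x * q + real_of_int c') \<cdot>\<^sub>m 1\<^sub>m n - int_mat n ?M'" .
  have "(\<Sum>i<n. ?B' $$ (i, i)) = x * (\<Sum>i<n. B $$ (i, i)) + real_of_int (trace_from 0 M)"
    using Cons.prems(1,3)
    by (simp add: int_mat_def trace_from_eq square_rows_def sum.distrib sum_distrib_left)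
  then have trB: "(\<Sum>i<n. ?B' $$ (i, i)) = x * (\<Sum>i<n. B $$ (i, i)) + real (Suc (length cs)) * c"
    by (simp add: tr)
  have B': "?B' \<in> carrier_mat n n" by simp
  from Cons.IH[OF ms(1) lev B' step] obtain B'' where B'': "B'' \<in> carrier_mat n n"
    "(x \<cdot>\<^sub>m 1\<^sub>m n - ?A) * B'' =
        (x ^ length cs * (x * q + real_of_int c') + poly (Poly (map real_of_int (rev cs))) x) \<cdot>\<^sub>m 1\<^sub>m n"
    "(\<Sum>i<n. B'' $$ (i, i)) = x ^ length cs * (x * (\<Sum>i<n. B $$ (i, i)) + real (Suc (length cs)) * c) +
        poly (pderiv (Poly (map real_of_int (rev (c' # cs))))) x"
    unfolding trB by blast
  have pd: "poly (pderiv (Poly (map real_of_int (rev (a # as))))) x =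
      real (length as) * a * x ^ (length as - 1) + poly (pderiv (Poly (map real_of_int (rev as)))) x" for a as
    by (simp add: Poly_snoc poly_monom pderiv_add pderiv_monom smult_monom del: monom_Suc)
  have po: "poly (Poly (map real_of_int (rev (a # as)))) x =
      a * x ^ length as + poly (Poly (map real_of_int (rev as))) x" for a as
    by (simp add: Poly_snoc poly_monom)
  have e1: "x ^ length cs * (x * q + real_of_int c') + poly (Poly (map real_of_int (rev cs))) x =
      x ^ length (c' # cs) * q + poly (Poly (map real_of_int (rev (c' # cs)))) x"
    unfolding po[of c'] by (simp add: algebra_simps)
  define P where "P = poly (pderiv (Poly (map real_of_int (rev (c' # cs))))) x"
  have e2: "x ^ length cs * (x * (\<Sum>i<n. B $$ (i, i)) + real (Suc (length cs)) * c) + P =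
      x ^ length (c' # cs) * (\<Sum>i<n. B $$ (i, i)) +
      poly (pderiv (Poly (map real_of_int (rev (c # c' # cs))))) x"
    unfolding pd[of c "c' # cs"] P_def[symmetric] by (simp add: algebra_simps)
  show ?case
    by (rule exI[of _ B'']) (intro conjI B''(1) B''(2)[unfolded e1] B''(3)[folded P_def, unfolded e2])
qed

definition id_rows :: "nat \<Rightarrow> int list list" where
  "id_rows n = map (\<lambda>i. (replicate n 0)[i := 1]) [0..<n]"

lemma char_poly_leverrier:
  assumes L: "wf_rows L" and lev: "leverrier L 1 (id_rows (length L)) cs" "length cs = length L"
  shows "char_poly (rows_matrix L) = Poly (map real_of_int (rev (1 # cs)))"
proof -
  let ?n = "length L" and ?q = "Poly (map real_of_int (rev (1 # cs)))"
  have sq: "square_rows ?n (id_rows ?n)" by (auto simp: square_rows_def id_rows_def)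
  have id: "int_mat ?n (id_rows ?n) = 1\<^sub>m ?n"
    by (rule eq_matI) (auto simp: int_mat_def id_rows_def nth_list_update)
  have "\<exists>B'. B' \<in> carrier_mat ?n ?n \<and> (x \<cdot>\<^sub>m 1\<^sub>m ?n - rows_matrix L) * B' = poly ?q x \<cdot>\<^sub>m 1\<^sub>m ?n \<and>
      (\<Sum>i<?n. B' $$ (i, i)) = poly (pderiv ?q) x" for x
  proof -
    have C: "x \<cdot>\<^sub>m 1\<^sub>m ?n - rows_matrix L \<in> carrier_mat ?n ?n"
      by (rule minus_carrier_mat) (simp add: rows_matrix_def)
    \<comment> \<open>The Horner scheme starts with nothing collected, the leading coefficient 1 and
      the identity matrix.\<close>
    have "(x \<cdot>\<^sub>m 1\<^sub>m ?n - rows_matrix L) * 0\<^sub>m ?n ?n = 1 \<cdot>\<^sub>m 1\<^sub>m ?n - int_mat ?n (id_rows ?n)"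
      unfolding id by (subst right_mult_zero_mat[OF C]) (auto intro!: eq_matI)
    from leverrier_sound[OF L refl sq lev(1) _ this]
    show ?thesis by (simp add: Poly_snoc poly_monom add.commute[of "x ^ length cs"])
  qed
  \<comment> \<open>The cofactor matrix was found for each \<open>x\<close> separately. It may
    depend on \<open>x\<close> in any way, since \<open>char_poly_eqI\<close> argues
    pointwise.\<close>
  then have "\<exists>B. \<forall>x. B x \<in> carrier_mat ?n ?n \<and>
      (x \<cdot>\<^sub>m 1\<^sub>m ?n - rows_matrix L) * B x = poly ?q x \<cdot>\<^sub>m 1\<^sub>m ?n \<and>
      (\<Sum>i<?n. B x $$ (i, i)) = poly (pderiv ?q) x"
    by (intro choice allI)
  then obtain B where B: "\<forall>x. B x \<in> carrier_mat ?n ?n \<and>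
      (x \<cdot>\<^sub>m 1\<^sub>m ?n - rows_matrix L) * B x = poly ?q x \<cdot>\<^sub>m 1\<^sub>m ?n \<and>
      (\<Sum>i<?n. B x $$ (i, i)) = poly (pderiv ?q) x" ..
  have cf: "coeff ?q i = (if i = ?n then 1 else if i < ?n then real_of_int (rev cs ! i) else 0)" for i
    using lev(2) by (auto simp: nth_default_def nth_append)
  have "degree ?q = ?n" by (intro antisym degree_le le_degree) (unfold cf, auto)
  moreover have "lead_coeff ?q = 1" unfolding \<open>degree ?q = ?n\<close> cf by simp
  moreover have "rows_matrix L \<in> carrier_mat ?n ?n" by (simp add: rows_matrix_def)
  ultimately show ?thesis 
    by (intro char_poly_eqI[where B = B and n = ?n]) (use B in \<open>blast\<close>)+
qed

section \<open>Scaling a spectrum that is entirely real\<close>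

lemma split_of_size_proots:
  fixes p :: "'a :: idom poly"
  assumes "p \<noteq> 0" "size (proots p) = degree p"
  shows "p = Polynomial.smult (lead_coeff p) (\<Prod>r\<in>#proots p. [:- r, 1:])"
  using assms
proof (induction p rule: poly_root_order_induct)
  case (no_roots p)
  then have "proots p = {#}" by (simp add: multiset_eq_iff order_root)
  with no_roots have "degree p = 0" by simp
  then obtain a where "p = [:a:]" by (rule degree_eq_zeroE)
  then show ?case by simp
next
  case (root p x n)
  then have p: "p \<noteq> 0" by auto
  have pr: "proots ([:- x, 1:] ^ n * p) = replicate_mset n x + proots p"
    using p by (simp add: proots_mult proots_power)
  have "size (proots p) = degree p"
    using root.prems p by (simp add: pr degree_mult_eq degree_power_eq)
  then have IH: "p = Polynomial.smult (lead_coeff p) (\<Prod>r\<in>#proots p. [:- r, 1:])" using root.IH p by blast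
  have "lead_coeff ([:- x, 1:] ^ n * p) = lead_coeff p" by (simp add: lead_coeff_mult lead_coeff_power)
  then show ?case unfolding pr by (subst IH) (simp add: mult.commute)
qed auto

text \<open>The characteristic polynomial of \<open>c A\<close> at \<open>x\<close> is
  \<open>c^n\<close> times that of \<open>A\<close> at \<open>x / c\<close>. As the latter splits
  into linear factors by \<open>full\<close>, the powers of \<open>c\<close> can be distributed over
  them, turning \<open>x / c - r\<close> into \<open>x - c r\<close>.\<close>

lemma proots_char_poly_smult:
  fixes A :: "real mat"
  assumes A: "A \<in> carrier_mat n n" and c: "c \<noteq> 0" and full: "size (proots (char_poly A)) = n"
  shows "proots (char_poly (c \<cdot>\<^sub>m A)) = image_mset ((*) c) (proots (char_poly A))"
proof -
  let ?T = "proots (char_poly A)"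
  have m: "degree (char_poly A) = n" "lead_coeff (char_poly A) = 1" "char_poly A \<noteq> 0"
    using degree_monic_char_poly[OF A] by auto
  have p: "char_poly A = (\<Prod>r\<in>#?T. [:- r, 1:])"
    using split_of_size_proots[of "char_poly A"] m full by simp
  have "poly (char_poly (c \<cdot>\<^sub>m A)) x = poly (\<Prod>r\<in>#image_mset ((*) c) ?T. [:- r, 1:]) x" for x
  proof -
    have "x \<cdot>\<^sub>m 1\<^sub>m n - c \<cdot>\<^sub>m A = c \<cdot>\<^sub>m ((x / c) \<cdot>\<^sub>m 1\<^sub>m n - A)"
      using A c by (intro eq_matI) (auto simp: algebra_simps)
    then have "poly (char_poly (c \<cdot>\<^sub>m A)) x = c ^ n * poly (char_poly A) (x / c)"
      using A by (simp add: poly_char_poly[of _ n])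
    also have "\<dots> = c ^ size ?T * (\<Prod>r\<in>#?T. x / c - r)"
      unfolding full by (subst p) (simp add: poly_prod_mset)
    also have "c ^ size M * (\<Prod>r\<in>#M. x / c - r) = (\<Prod>r\<in>#M. x - c * r)" for M
      by (induction M) (use c in \<open>auto simp: field_simps\<close>)
    finally show ?thesis by (simp add: poly_prod_mset image_mset.compositionality o_def)
  qed
  then have "char_poly (c \<cdot>\<^sub>m A) = (\<Prod>r\<in>#image_mset ((*) c) ?T. [:- r, 1:])"
    by (simp add: poly_eq_poly_eq_iff[symmetric] fun_eq_iff)
  moreover have "proots (\<Prod>r\<in>#M. [:- r, 1:]) = M" for M :: "real multiset"
  proof (induction M)
    case (add x M)
    have "(\<Prod>r\<in>#M. [:- r, 1:]) \<noteq> 0" by (subst prod_mset_zero_iff) auto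
    with proots_mult[of "[:- x, 1:]" "\<Prod>r\<in>#M. [:- r, 1:]"] add show ?case
      by (simp del: mult_pCons_left)
  qed simp
  ultimately show ?thesis by metis
qed

section \<open>Isolation of real roots\<close>

text \<open>Polynomials are coefficient lists, lowest degree first, and an interval \<open>(a, b)\<close> stands for
  \<open>a < 1000 x < b\<close>.\<close>

fun scaled_value :: "int \<Rightarrow> int list \<Rightarrow> int" where
  "scaled_value a [] = 0"
| "scaled_value a (c # cs) = c * 1000 ^ length cs + a * scaled_value a cs"

text \<open>The bound \<open>m\<close> is the end of the preceding interval. Keeping the intervals
  in increasing order makes the roots found in them distinct.\<close>

fun isolates :: "int list \<Rightarrow> int \<Rightarrow> (int \<times> int) list \<Rightarrow> bool" where
  "isolates cs m [] = True"
| "isolates cs m ((a, b) # I) =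
    (m \<le> a \<and> a < b \<and> scaled_value a cs * scaled_value b cs < 0 \<and> isolates cs b I)"

fun poly_add :: "int list \<Rightarrow> int list \<Rightarrow> int list" where
  "poly_add [] q = q"
| "poly_add p [] = p"
| "poly_add (a # p) (b # q) = (a + b) # poly_add p q"

fun poly_scale :: "int \<Rightarrow> int list \<Rightarrow> int list" where
  "poly_scale a [] = []"
| "poly_scale a (b # q) = a * b # poly_scale a q"

fun poly_mult :: "int list \<Rightarrow> int list \<Rightarrow> int list" where
  "poly_mult [] q = []"
| "poly_mult (a # p) q = poly_add (poly_scale a q) (0 # poly_mult p q)"

fun factors_prod :: "(int list \<times> (int \<times> int) list) list \<Rightarrow> int list" where
  "factors_prod [] = [1]"
| "factors_prod ((f, I) # S) = poly_mult f (factors_prod S)"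

text \<open>\<open>- 4000\<close> is only a starting value to the left of all intervals.\<close>

fun factors_ok :: "(int list \<times> (int \<times> int) list) list \<Rightarrow> bool" where
  "factors_ok [] = True"
| "factors_ok ((f, I) # S) =
    (length f = Suc (length I) \<and> f ! length I = 1 \<and> isolates f (- 4000) I \<and> factors_ok S)"

text \<open>If \<open>a < 1000 r < b\<close>, then \<open>1000 |r|\<close> lies between
  \<open>max a (- b)\<close> and \<open>max b (- a)\<close>, whatever the sign of \<open>r\<close>.
  For an interval around 0 the lower bound is negative but still valid.\<close>

fun lower_sum :: "(int \<times> int) list \<Rightarrow> int" where
  "lower_sum [] = 0"
| "lower_sum ((a, b) # I) = max a (- b) + lower_sum I"

fun upper_sum :: "(int \<times> int) list \<Rightarrow> int" where
  "upper_sum [] = 0"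
| "upper_sum ((a, b) # I) = max b (- a) + upper_sum I"

definition spectrum_of :: "(int list \<times> (int \<times> int) list) list \<Rightarrow> real multiset" where
  "spectrum_of S = (\<Sum>(f, I)\<leftarrow>S. proots (Poly (map real_of_int f)))"

fun within_thousandths :: "real \<Rightarrow> int \<times> int \<Rightarrow> bool" where
  "within_thousandths r (a, b) \<longleftrightarrow> real_of_int a < 1000 * r \<and> 1000 * r < real_of_int b"

text \<open>For a nonempty list, \<open>scaled_value\<close> is the value at \<open>a / 1000\<close>
  times 1000 to the power \<open>length cs - 1\<close>, so signs are decided in integer arithmetic.
  The factor 1000 on the left stands in for the subtraction in the exponent.\<close>

lemma scaled_value_eq:
  "1000 * real_of_int (scaled_value a cs) = 1000 ^ length cs * poly (Poly (map real_of_int cs)) (a / 1000)"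
  by (induction cs) (simp_all add: algebra_simps)

text \<open>Each sign change yields a root by the intermediate value theorem. The lower bound
  \<open>m\<close> is carried through the induction because it separates the new root from all later
  ones.\<close>

lemma isolates_roots:
  assumes "isolates cs m I"
  shows "\<exists>rs. distinct rs \<and> (\<forall>r\<in>set rs. real_of_int m < 1000 * r \<and> poly (Poly (map real_of_int cs)) r = 0) \<and>
     list_all2 within_thousandths rs I"
  using assms
proof (induction cs m I rule: isolates.induct)
  case (1 cs m)
  then show ?case by (intro exI[of _ "[]"]) auto
next
  case (2 cs m a b I)
  let ?p = "Poly (map real_of_int cs)" and ?k = "1000 ^ length cs :: real"
  from 2 obtain rs where rs: "distinct rs" "\<forall>r\<in>set rs. real_of_int b < 1000 * r \<and> poly ?p r = 0"
    "list_all2 within_thousandths rs I"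
    by auto
  have "real_of_int (scaled_value a cs * scaled_value b cs) < 0"
    using "2.prems" unfolding of_int_less_0_iff by simp
  then have "(1000 * real_of_int (scaled_value a cs)) * (1000 * real_of_int (scaled_value b cs)) < 0"
    by simp
  then have "(?k * ?k) * (poly ?p (a / 1000) * poly ?p (b / 1000)) < 0"
    unfolding scaled_value_eq by (simp add: mult_ac)
  then have "poly ?p (a / 1000) * poly ?p (b / 1000) < 0"
    by (simp add: mult_less_0_iff zero_less_mult_iff)
  moreover have "a / 1000 < (b / 1000 :: real)" using "2.prems" by simp
  ultimately obtain r where r: "a / 1000 < r" "r < b / 1000" "poly ?p r = 0"
    using poly_IVT[of "a / 1000" "b / 1000" ?p] by auto
  have "m \<le> a" "a < b" using "2.prems" by auto
  with r rs show ?case by (intro exI[of _ "r # rs"]) fastforce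
qed

text \<open>Distinct roots form a submultiset of \<open>proots p\<close>, whose size is at most the
  degree, so none is missing and none is multiple.\<close>

lemma proots_eq_mset:
  fixes p :: "'a :: idom poly"
  assumes "p \<noteq> 0" "distinct rs" "\<forall>r\<in>set rs. poly p r = 0" "degree p \<le> length rs"
  shows "proots p = mset rs"
proof -
  have "mset rs \<subseteq># proots p"
  proof (rule mset_subset_eqI)
    fix r
    have "count (mset rs) r = (if r \<in> set rs then 1 else 0)"
      using assms(2) by (simp add: distinct_count_atmost_1)
    then show "count (mset rs) r \<le> count (proots p) r"
      using assms(1,3) by (auto simp: count_proots order_gt_0_iff Suc_le_eq)
  qed
  moreover have "size (proots p) \<le> size (mset rs)"
    using size_proots_le[of p] assms(4) by simp
  ultimately show ?thesis
    by (metis mset_subset_size subset_mset.le_imp_less_or_eq verit_comp_simplify1(3))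
qed

lemma monic_Poly:
  assumes "length f = Suc n" "f ! n = (1 :: int)"
  shows "Poly (map real_of_int f) \<noteq> 0" "degree (Poly (map real_of_int f)) \<le> n"
proof -
  have c: "coeff (Poly (map real_of_int f)) i = (if i \<le> n then real_of_int (f ! i) else 0)" for i
    using assms by (simp add: nth_default_def)
  show "degree (Poly (map real_of_int f)) \<le> n" by (rule degree_le) (use assms in \<open>auto simp: nth_default_def\<close>)
  show "Poly (map real_of_int f) \<noteq> 0"
    using c[of n] assms by (metis coeff_0 of_int_1 order_refl zero_neq_one)
qed

lemma sum_abs_bounds:
  fixes rs :: "real list"
  assumes "list_all2 within_thousandths rs I"
  shows "lower_sum I \<le> 1000 * (\<Sum>r\<leftarrow>rs. \<bar>r\<bar>) \<and> 1000 * (\<Sum>r\<leftarrow>rs. \<bar>r\<bar>) \<le> upper_sum I"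
  using assms by (induction rs I rule: list_all2_induct) auto

lemma Poly_poly_add: "Poly (map real_of_int (poly_add p q)) = Poly (map real_of_int p) + Poly (map real_of_int q)"
  by (induction p q rule: poly_add.induct) auto

lemma Poly_poly_scale: "Poly (map real_of_int (poly_scale a q)) = Polynomial.smult (real_of_int a) (Poly (map real_of_int q))"
  by (induction q) auto

lemma Poly_poly_mult: "Poly (map real_of_int (poly_mult p q)) = Poly (map real_of_int p) * Poly (map real_of_int q)"
  by (induction p) (auto simp: Poly_poly_add Poly_poly_scale)

text \<open>Multiple eigenvalues arise from different entries of the list, repeated if necessary.
  Within one factor the intervals are as many as the degree allows, so all its roots are real and
  simple, and root multisets add up over products.\<close>

lemma factors_ok_sound:
  assumes "factors_ok S"
  shows "Poly (map real_of_int (factors_prod S)) \<noteq> 0 \<and>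
    proots (Poly (map real_of_int (factors_prod S))) = spectrum_of S \<and>
    size (spectrum_of S) = (\<Sum>(f, I)\<leftarrow>S. length I) \<and>
    (\<Sum>(f, I)\<leftarrow>S. lower_sum I) \<le> 1000 * (\<Sum>x\<in>#spectrum_of S. \<bar>x\<bar>) \<and>
    1000 * (\<Sum>x\<in>#spectrum_of S. \<bar>x\<bar>) \<le> (\<Sum>(f, I)\<leftarrow>S. upper_sum I)"
  using assms
proof (induction S rule: factors_ok.induct)
  case 1
  then show ?case by (simp add: spectrum_of_def one_pCons[symmetric])
next
  case (2 f I S)
  let ?p = "Poly (map real_of_int f)"
  from 2 have f: "length f = Suc (length I)" "f ! length I = 1" "isolates f (- 4000) I" and S: "factors_ok S"
    by auto
  from isolates_roots[OF f(3)] obtain rs where rs: "distinct rs" "\<forall>r\<in>set rs. poly ?p r = 0"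
    "list_all2 within_thousandths rs I" by blast
  note m = monic_Poly[OF f(1,2)]
  have len: "length rs = length I" using rs(3) by (rule list_all2_lengthD)
  have pr: "proots ?p = mset rs" using m rs len by (intro proots_eq_mset) auto
  have sp: "spectrum_of ((f, I) # S) = mset rs + spectrum_of S" by (simp add: spectrum_of_def pr)
  have "(\<Sum>x\<in>#mset rs. \<bar>x\<bar>) = (\<Sum>r\<leftarrow>rs. \<bar>r\<bar>)" by (metis mset_map sum_mset_sum_list)
  with sum_abs_bounds[OF rs(3)] "2.IH"[OF S] m len show ?case
    by (simp add: sp Poly_poly_mult proots_mult pr algebra_simps)
qed

text \<open>The claimed factors are multiplied out and the product is verified. \<open>rev\<close>
  puts the highest degree first, as \<open>leverrier\<close> expects, and the leading coefficient 1
  is split off.\<close>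

fun spectrum_cert :: "nat list list \<Rightarrow> (int list \<times> (int \<times> int) list) list \<Rightarrow> bool" where
  "spectrum_cert L S = (factors_ok S \<and> (\<Sum>(f, I)\<leftarrow>S. length I) = length L \<and>
     (case rev (factors_prod S) of [] \<Rightarrow> False
      | c # cs \<Rightarrow> c = 1 \<and> length cs = length L \<and> leverrier L 1 (id_rows (length L)) cs))"

fun spectrum_certs :: "nat list list list \<Rightarrow> (int list \<times> (int \<times> int) list) list list \<Rightarrow> bool" where
  "spectrum_certs [] [] = True"
| "spectrum_certs (L # G) (S # T) = (spectrum_cert L S \<and> spectrum_certs G T)"
| "spectrum_certs _ _ = False"

section \<open>Exploration of cubic graphs\<close>

text \<open>A partially explored cubic graph on at most 10 vertices is a pair \<open>(D, R)\<close>: \<open>D\<close> holds, in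
  reverse order, the complete neighbour lists of the processed vertices \<open>0, \<dots>, v - 1\<close>, and \<open>R\<close> the
  neighbours among \<open>0, \<dots>, v - 1\<close> of the vertices \<open>v, v + 1, \<dots>\<close> that have been reached.
  \<open>extend v d u R\<close> lists the ways to give \<open>v\<close> a further \<open>d\<close> neighbours among the reached vertices
  \<open>u, u + 1, \<dots>\<close> with rows \<open>R\<close>, the missing ones being fresh vertices; these are interchangeable, hence
  numbered consecutively. The state \<open>(D, [])\<close> means that a component is complete.\<close>

fun extend :: "nat \<Rightarrow> nat \<Rightarrow> nat \<Rightarrow> nat list list \<Rightarrow> (nat list list \<times> nat list) list" where
  "extend v d u [] = (if u + d \<le> 10 then [(replicate d [v], [u..<u + d])] else [])"
| "extend v d u (r # R) =
    map (\<lambda>(R', c). (r # R', c)) (extend v d (Suc u) R) @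
    (if 0 < d \<and> length r < 3
     then map (\<lambda>(R', c). ((v # r) # R', u # c)) (extend v (d - 1) (Suc u) R) else [])"

fun process :: "nat \<Rightarrow> nat list \<Rightarrow> nat list list \<Rightarrow> nat list list \<Rightarrow> (nat list list \<times> nat list list) list" where
  "process v r D R = map (\<lambda>(R', c). ((r @ c) # D, R')) (extend v (3 - length r) (Suc v) R)"

fun successors :: "nat \<Rightarrow> (nat list list \<times> nat list list) list \<Rightarrow> (nat list list \<times> nat list list) list" where
  "successors v [] = []"
| "successors v ((D, []) # S) = process v [] D [] @ successors v S"
| "successors v ((D, r # R) # S) = process v r D R @ successors v S"

fun descend :: "nat \<Rightarrow> nat \<Rightarrow> (nat list list \<times> nat list list) list \<Rightarrow> (nat list list \<times> nat list list) list" where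
  "descend v 0 S = S"
| "descend v (Suc n) S = descend (Suc v) n (successors v S)"

text \<open>A given graph guides the search: \<open>ys\<close> are the reached vertices belonging to
  the rows \<open>R\<close>, \<open>W\<close> the neighbours that \<open>v\<close> still lacks, and
  \<open>zs\<close> any listing of those not yet reached. At each row, membership in
  \<open>W\<close> selects the branch.\<close>

lemma extend_complete:
  assumes "length ys = length R" "distinct ys" "finite W" "card W = d" "distinct zs"
    and "set zs = W - set ys" "u + length ys + length zs \<le> 10"
    and "\<forall>i<length R. ys ! i \<in> W \<longrightarrow> length (R ! i) < 3"
  shows "\<exists>R' c. (R', c) \<in> set (extend v d u R) \<and> length R' = length ys + length zs \<and>
    (\<forall>i<length R'. R' ! i = (if (ys @ zs) ! i \<in> W then [v] else []) @ (if i < length R then R ! i else [])) \<and>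
    set c = {u + i | i. i < length R' \<and> (ys @ zs) ! i \<in> W}"
  using assms
proof (induction R arbitrary: ys u W d)
  case Nil
  then have d: "length zs = d" "set zs = W" using distinct_card[of zs] by auto
  have "set [u..<u + d] = {u + i | i. i < d \<and> zs ! i \<in> W}"
  proof (rule Set.set_eqI)
    fix j
    show "j \<in> set [u..<u + d] \<longleftrightarrow> j \<in> {u + i | i. i < d \<and> zs ! i \<in> W}"
      using d by (auto intro!: exI[of _ "j - u"])
  qed
  with Nil d show ?case
    by (intro exI[of _ "replicate d [v]"] exI[of _ "[u..<u + d]"]) auto
next
  case (Cons r R)
  then obtain y ys' where ys: "ys = y # ys'" by (cases ys) auto
  \<comment> \<open>\<open>W - {y}\<close> equals \<open>W\<close> when \<open>y\<close> is not a
    neighbour, so one instance of the induction hypothesis serves both branches.\<close>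
  have "\<exists>R' c. (R', c) \<in> set (extend v (card (W - {y})) (Suc u) R) \<and> length R' = length ys' + length zs \<and>
    (\<forall>i<length R'. R' ! i = (if (ys' @ zs) ! i \<in> W - {y} then [v] else []) @ (if i < length R then R ! i else [])) \<and>
    set c = {Suc u + i | i. i < length R' \<and> (ys' @ zs) ! i \<in> W - {y}}"
  proof (rule Cons.IH)
    show "\<forall>i<length R. ys' ! i \<in> W - {y} \<longrightarrow> length (R ! i) < 3"
      using Cons.prems(8) by (auto simp: ys)
  qed (use Cons.prems in \<open>auto simp: ys\<close>)
  then obtain R' c where *: "(R', c) \<in> set (extend v (card (W - {y})) (Suc u) R)"
    "length R' = length ys' + length zs"
    "\<And>i. i < length R' \<Longrightarrow> R' ! i = (if (ys' @ zs) ! i \<in> W - {y} then [v] else []) @ (if i < length R then R ! i else [])"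
    "set c = {Suc u + i | i. i < length R' \<and> (ys' @ zs) ! i \<in> W - {y}}" by blast
  have "y \<notin> set (ys' @ zs)" using Cons.prems by (auto simp: ys)
  then have mem: "(ys' @ zs) ! i \<in> W - {y} \<longleftrightarrow> (ys' @ zs) ! i \<in> W" if "i < length R'" for i
    using that *(2) nth_mem[of i "ys' @ zs"] by auto
  let ?R = "((if y \<in> W then [v] else []) @ r) # R'" and ?c = "(if y \<in> W then [u] else []) @ c"
  have "(?R, ?c) \<in> set (extend v d u (r # R))"
  proof (cases "y \<in> W")
    case True
    then have "card (W - {y}) = d - 1" "0 < d" "length r < 3"
      using Cons.prems(3,4,8) by (auto simp: ys card_gt_0_iff)
    then show ?thesis using * True by force
  next
    case False
    then show ?thesis using * Cons.prems(4) by force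
  qed
  moreover have "\<forall>i<length ?R. ?R ! i = (if (ys @ zs) ! i \<in> W then [v] else []) @ (if i < length (r # R) then (r # R) ! i else [])"
    using *(3) mem by (auto simp: ys nth_Cons split: nat.splits)
  moreover have "set ?c = {u + i | i. i < length ?R \<and> (ys @ zs) ! i \<in> W}"
  proof (rule Set.set_eqI)
    fix j
    have "j \<in> set c \<longleftrightarrow> (\<exists>i<length R'. j = Suc u + i \<and> (ys' @ zs) ! i \<in> W)"
      using *(4) mem by auto
    moreover have "(\<exists>i<length ?R. j = u + i \<and> (ys @ zs) ! i \<in> W) \<longleftrightarrow>
      (j = u \<and> y \<in> W) \<or> (\<exists>i<length R'. j = Suc u + i \<and> (ys' @ zs) ! i \<in> W)"
      by (simp add: ys Ex_less_Suc2)
    ultimately have "j \<in> set ?c \<longleftrightarrow> (\<exists>i<length ?R. j = u + i \<and> (ys @ zs) ! i \<in> W)"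
      by auto
    then show "j \<in> set ?c \<longleftrightarrow> j \<in> {u + i | i. i < length ?R \<and> (ys @ zs) ! i \<in> W}"
      by blast
  qed
  ultimately show ?case using *(2) by (intro exI[of _ ?R] exI[of _ ?c]) (simp add: ys)
qed

section \<open>Completeness of the search for a given cubic graph\<close>

locale cubic10 =
  fixes V :: "'a set" and N :: "'a \<Rightarrow> 'a set"
  assumes card_V: "card V = 10"
    and N_subset: "x \<in> V \<Longrightarrow> N x \<subseteq> V"
    and card_N: "x \<in> V \<Longrightarrow> card (N x) = 3"
    and N_irrefl: "x \<notin> N x"
    and N_sym: "y \<in> N x \<Longrightarrow> x \<in> N y"
begin

lemma finite_V: "finite V"
  by (rule card_ge_0_finite) (simp add: card_V)

lemma finite_N: "x \<in> V \<Longrightarrow> finite (N x)"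
  using finite_V N_subset finite_subset by blast

text \<open>\<open>xs\<close> lists the reached vertices in the order of their numbers.\<close>

definition explored :: "nat \<Rightarrow> nat list list \<Rightarrow> nat list list \<Rightarrow> 'a list \<Rightarrow> bool" where
  "explored v D R xs \<longleftrightarrow> length D = v \<and> length xs = v + length R \<and> distinct xs \<and> set xs \<subseteq> V \<and>
     (\<forall>i<v. N (xs ! i) \<subseteq> set xs \<and> set (rev D ! i) = {j. j < length xs \<and> xs ! j \<in> N (xs ! i)}) \<and>
     (\<forall>i<length R. distinct (R ! i) \<and> set (R ! i) = {j. j < v \<and> xs ! j \<in> N (xs ! (v + i))})"

lemma card_indices:
  assumes "distinct xs" "v \<le> length xs"
  shows "card {j. j < v \<and> xs ! j \<in> A} = card (A \<inter> set (take v xs))"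
proof -
  have "bij_betw ((!) xs) {j. j < v \<and> xs ! j \<in> A} (A \<inter> set (take v xs))"
    using assms by (auto simp: bij_betw_def inj_on_def nth_eq_iff_index_eq nth_image[symmetric])
  then show ?thesis by (rule bij_betw_same_card)
qed

text \<open>The branch taken is dictated by the neighbours of the vertex \<open>y\<close> with
  number \<open>v\<close>. Fresh neighbours may be appended in any order, since no earlier vertex is
  adjacent to them and all of them receive the row \<open>[v]\<close>.\<close>

lemma explored_process:
  assumes ex: "explored v D (r # R) xs"
  shows "\<exists>D' R' zs. (D', R') \<in> set (process v r D R) \<and> explored (Suc v) D' R' (xs @ zs)"
proof -
  define y where "y = xs ! v"
  define W where "W = N y - set (take v xs)"
  define ys where "ys = drop (Suc v) xs"
  have D: "length D = v" and len: "length xs = Suc (v + length R)" and dist: "distinct xs" and sub: "set xs \<subseteq> V"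
    and closed: "\<And>i. i < v \<Longrightarrow> N (xs ! i) \<subseteq> set xs"
      "\<And>i. i < v \<Longrightarrow> set (rev D ! i) = {j. j < length xs \<and> xs ! j \<in> N (xs ! i)}"
    and r: "distinct r" "set r = {j. j < v \<and> xs ! j \<in> N y}"
    and R: "\<And>i. i < length R \<Longrightarrow> distinct (R ! i)"
      "\<And>i. i < length R \<Longrightarrow> set (R ! i) = {j. j < v \<and> xs ! j \<in> N (xs ! (Suc v + i))}"
    using ex by (auto simp: explored_def y_def All_less_Suc2)
  have yV: "y \<in> V" using sub len by (auto simp: y_def)
  have xs: "xs = take v xs @ y # ys" using len by (simp add: y_def ys_def id_take_nth_drop)
  have dist': "distinct (take v xs @ y # ys)" using dist xs by simp
  have finW: "finite W" using finite_N[OF yV] by (simp add: W_def)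
  have "card W = card (N y) - card (N y \<inter> set (take v xs))"
    unfolding W_def by (simp add: card_Diff_subset_Int finite_N[OF yV])
  also have "card (N y \<inter> set (take v xs)) = length r"
    using card_indices[OF dist, of v "N y"] len distinct_card[OF r(1)] r(2) by simp
  finally have cW: "card W = 3 - length r" by (simp add: card_N yV)
  obtain zs where zs: "set zs = W - set ys" "distinct zs"
    using finite_distinct_list[of "W - set ys"] finW by auto
  have WV: "W \<subseteq> V" using N_subset[OF yV] by (auto simp: W_def)
  have zx: "x \<notin> set xs" if "x \<in> set zs" for x
    using that zs N_irrefl[of y] xs by (metis DiffE UnE W_def set_append set_ConsD)
  have dz: "distinct (xs @ zs)" using dist zs zx by auto
  have sz: "set (xs @ zs) \<subseteq> V" using sub zs WV by auto
  have "length (xs @ zs) \<le> 10"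
    using card_mono[OF finite_V sz] distinct_card[OF dz] card_V by simp
  then have bound: "Suc v + length ys + length zs \<le> 10" using len by (simp add: ys_def)
  have ysR: "length ys = length R" using len by (simp add: ys_def)
  have ysn: "ys ! i = xs ! (Suc v + i)" if "i < length R" for i using that len by (simp add: ys_def)
  \<comment> \<open>One of the three neighbours of such a vertex is \<open>y\<close>, which is not
    yet processed, so at most two are recorded. This meets the guard \<open>length r < 3\<close> in
    \<open>extend\<close>.\<close>
  have short: "length (R ! i) < 3" if i: "i < length R" and w: "ys ! i \<in> W" for i
  proof -
    let ?x = "ys ! i"
    have xV: "?x \<in> V" using w WV by auto
    have "y \<in> N ?x" using w N_sym by (auto simp: W_def)
    moreover have "y \<notin> set (take v xs)" using dist' by simp
    ultimately have "card (N ?x \<inter> set (take v xs)) < card (N ?x)"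
      using finite_N[OF xV] by (intro psubset_card_mono) auto
    moreover have "length (R ! i) = card (N ?x \<inter> set (take v xs))"
      using card_indices[OF dist, of v "N ?x"] len R[OF i] distinct_card[of "R ! i"] ysn[OF i] by simp
    ultimately show ?thesis using card_N[OF xV] by simp
  qed
  have disty: "distinct ys" using dist' by simp
  have "\<forall>i<length R. ys ! i \<in> W \<longrightarrow> length (R ! i) < 3" using short by blast
  from extend_complete[OF ysR disty finW cW zs(2) zs(1) bound this, of v] obtain R' c
    where R'c: "(R', c) \<in> set (extend v (3 - length r) (Suc v) R)" and lenR': "length R' = length ys + length zs"
    and R': "\<And>i. i < length R' \<Longrightarrow>
      R' ! i = (if (ys @ zs) ! i \<in> W then [v] else []) @ (if i < length R then R ! i else [])"
    and c: "set c = {Suc v + i | i. i < length R' \<and> (ys @ zs) ! i \<in> W}" by blast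
  let ?xs = "xs @ zs"
  have lenx: "length ?xs = Suc v + length R'" using lenR' ysR len by simp
  have nthx: "?xs ! (Suc v + i) = (ys @ zs) ! i" for i
    using ysR len by (auto simp: nth_append ys_def)
  have nv: "?xs ! v = y" using len by (simp add: y_def nth_append)
  have lt: "?xs ! j = xs ! j" if "j < length xs" for j using that by (simp add: nth_append)
  have W_iff: "(ys @ zs) ! i \<in> W \<longleftrightarrow> (ys @ zs) ! i \<in> N y" if "i < length R'" for i
  proof -
    have "(ys @ zs) ! i \<in> set (ys @ zs)" using that lenR' by (intro nth_mem) simp
    moreover have "set (ys @ zs) \<inter> set (take v xs) = {}" using dist' zx by (auto dest: in_set_takeD)
    ultimately show ?thesis by (auto simp: W_def)
  qed
  \<comment> \<open>Processed vertices have all their neighbours in \<open>xs\<close>, hence none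
    among the appended \<open>zs\<close>, and their rows stay correct.\<close>
  have old: "{j. j < length ?xs \<and> ?xs ! j \<in> N (?xs ! i)} = {j. j < length xs \<and> xs ! j \<in> N (xs ! i)}" if i: "i < v" for i
  proof (rule Set.set_eqI)
    fix j
    have "j < length xs" if "j < length ?xs" "?xs ! j \<in> N (xs ! i)"
    proof (rule ccontr)
      assume "\<not> j < length xs"
      then have "?xs ! j \<in> set zs" using that by (auto simp: nth_append)
      then show False using zx that(2) closed(1)[OF i] by blast
    qed
    then show "j \<in> {j. j < length ?xs \<and> ?xs ! j \<in> N (?xs ! i)} \<longleftrightarrow> j \<in> {j. j < length xs \<and> xs ! j \<in> N (xs ! i)}"
      using i len lt by auto
  qed
  have split: "j < length ?xs \<longleftrightarrow> j < v \<or> j = v \<or> (\<exists>i<length R'. j = Suc v + i)" for j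
    unfolding lenx by (auto intro!: exI[of _ "j - Suc v"])
  have "explored (Suc v) ((r @ c) # D) R' ?xs"
    unfolding explored_def
  proof (intro conjI allI impI)
    show "length ((r @ c) # D) = Suc v" by (simp add: D)
    show "length ?xs = Suc v + length R'" by (rule lenx)
    show "distinct ?xs" "set ?xs \<subseteq> V" by fact+
  next
    fix i assume i: "i < Suc v"
    show "N (?xs ! i) \<subseteq> set ?xs"
    proof (cases "i = v")
      case True
      have "N y \<subseteq> set (take v xs) \<union> (set ys \<union> set zs)" using zs by (auto simp: W_def)
      also have "\<dots> \<subseteq> set ?xs" by (auto simp: ys_def dest: in_set_takeD in_set_dropD)
      finally show ?thesis using True nv by simp
    next
      case False
      then show ?thesis using i closed(1)[of i] lt[of i] len by auto
    qed
    show "set (rev ((r @ c) # D) ! i) = {j. j < length ?xs \<and> ?xs ! j \<in> N (?xs ! i)}"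
    proof (cases "i = v")
      case True
      have "j \<in> set r \<union> set c \<longleftrightarrow> j < length ?xs \<and> ?xs ! j \<in> N y" for j
        unfolding split r(2) c using W_iff nthx nv N_irrefl[of y] lt len by auto
      then have "set (r @ c) = {j. j < length ?xs \<and> ?xs ! j \<in> N y}" by auto
      moreover have "rev ((r @ c) # D) ! i = r @ c" using True D by (simp add: nth_append)
      ultimately show ?thesis unfolding True nv by simp
    next
      case False
      with i have i': "i < v" by simp
      then have "rev ((r @ c) # D) ! i = rev D ! i" using D by (simp add: nth_append)
      then show ?thesis using closed(2)[OF i'] unfolding old[OF i'] by simp
    qed
  next
    fix i assume i: "i < length R'"
    let ?x = "(ys @ zs) ! i"
    have v: "v \<notin> set (R ! i)" if "i < length R" using R(2)[OF that] by auto
    show "distinct (R' ! i)" using R'[OF i] R(1)[of i] v by auto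
    \<comment> \<open>A vertex of \<open>zs\<close> adjacent to a processed one would already lie in
      \<open>xs\<close>; its row therefore starts empty.\<close>
    have new: "j < v \<Longrightarrow> xs ! j \<notin> N ?x" if "\<not> i < length R" for j
    proof
      assume j: "j < v" "xs ! j \<in> N ?x"
      have "?x \<in> set zs" using that i lenR' ysR by (auto simp: nth_append)
      then show False using closed(1)[OF j(1)] N_sym[OF j(2)] zx by auto
    qed
    have yx: "y \<in> N ?x \<longleftrightarrow> ?x \<in> W" using W_iff[OF i] N_sym by blast
    have oldrow: "set (R ! i) = {j. j < v \<and> xs ! j \<in> N ?x}" if "i < length R"
      using R(2)[OF that] ysn[OF that] that ysR by (simp add: nth_append)
    have row: "set (if i < length R then R ! i else []) = {j. j < v \<and> xs ! j \<in> N ?x}"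
      using oldrow new by (cases "i < length R") auto
    have "j \<in> set (R' ! i) \<longleftrightarrow> j < Suc v \<and> ?xs ! j \<in> N ?x" for j
      unfolding R'[OF i] set_append row using yx nv lt[of j] len by (auto simp: less_Suc_eq)
    then show "set (R' ! i) = {j. j < Suc v \<and> ?xs ! j \<in> N (?xs ! (Suc v + i))}"
      unfolding nthx by blast
  qed
  moreover have "((r @ c) # D, R') \<in> set (process v r D R)" using R'c by force
  ultimately show ?thesis by blast
qed

text \<open>With no reached vertex waiting, \<open>xs\<close> is closed under neighbourhoods and has
  fewer than ten elements. Any vertex outside starts a new component and has no processed
  neighbour.\<close>

lemma explored_fresh:
  assumes ex: "explored v D [] xs" and v: "v < 10"
  shows "\<exists>w. explored v D [[]] (xs @ [w])"
proof -
  have len: "length xs = v" and dist: "distinct xs" and sub: "set xs \<subseteq> V"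
    and closed: "\<And>i. i < v \<Longrightarrow> N (xs ! i) \<subseteq> set xs"
    using ex by (auto simp: explored_def)
  have "card (set xs) < card V" using distinct_card[OF dist] len v card_V by simp
  then have "set xs \<noteq> V" by auto
  then obtain w where w: "w \<in> V" "w \<notin> set xs" using sub by auto
  have new: "w \<notin> N (xs ! i)" if "i < v" for i using closed[OF that] w by auto
  then have "xs ! i \<notin> N w" if "i < v" for i using that N_sym by blast
  then show ?thesis using ex w new
    by (intro exI[of _ w]) (auto simp: explored_def nth_append less_Suc_eq)
qed

lemma successors_process:
  "(D, []) \<in> set S \<Longrightarrow> set (process v [] D []) \<subseteq> set (successors v S)"
  "(D, r # R) \<in> set S \<Longrightarrow> set (process v r D R) \<subseteq> set (successors v S)"
  by (induction v S rule: successors.induct) auto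

lemma successors_complete:
  assumes "explored v D R xs" "(D, R) \<in> set S" "v < 10"
  shows "\<exists>D' R' xs'. (D', R') \<in> set (successors v S) \<and> explored (Suc v) D' R' xs'"
proof (cases R)
  case Nil
  with assms explored_fresh[of v D xs] obtain w where "explored v D [[]] (xs @ [w])" by auto
  from explored_process[OF this] show ?thesis
    using successors_process(1)[of D S v] assms Nil by (simp del: process.simps) blast
next
  case (Cons r R')
  with explored_process[of v D r R' xs] assms show ?thesis
    using successors_process(2)[of D r R' S v] by (simp del: process.simps) blast
qed

lemma descend_complete:
  assumes "explored v D R xs" "(D, R) \<in> set S" "v + n \<le> 10"
  shows "\<exists>D' R' xs'. (D', R') \<in> set (descend v n S) \<and> explored (v + n) D' R' xs'"
  using assms
proof (induction n arbitrary: v S D R xs)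
  case 0
  then show ?case by auto
next
  case (Suc n)
  then obtain D' R' xs' where "(D', R') \<in> set (successors v S)" "explored (Suc v) D' R' xs'"
    using successors_complete[of v D R xs S] by auto
  from Suc.IH[OF this(2,1)] Suc.prems(3) show ?case by simp
qed

text \<open>After ten steps \<open>length xs = 10 + length R\<close>, while distinct vertices number
  at most ten; so \<open>R\<close> is empty and \<open>xs\<close> exhausts the vertices. The cut
  after five steps matches the grouping of the certificates.\<close>

lemma leaf_complete:
  "\<exists>s D xs. s \<in> set (descend 0 5 [([], [])]) \<and> (D, []) \<in> set (descend 5 5 [s]) \<and> length D = 10 \<and>
     distinct xs \<and> set xs = V \<and> (\<forall>i<10. set (rev D ! i) = {j. j < 10 \<and> xs ! j \<in> N (xs ! i)})"
proof -
  have "explored 0 [] [] []" by (simp add: explored_def)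
  from descend_complete[OF this, of "[([], [])]" 5] obtain D' R' xs'
    where s: "(D', R') \<in> set (descend 0 5 [([], [])])" "explored 5 D' R' xs'" by auto
  from descend_complete[OF s(2), of "[(D', R')]" 5] obtain D R xs
    where D: "(D, R) \<in> set (descend 5 5 [(D', R')])" "explored 10 D R xs" by auto
  then have xs: "distinct xs" "set xs \<subseteq> V" "length xs = 10 + length R" by (auto simp: explored_def)
  then have "length xs \<le> 10" using card_mono[OF finite_V xs(2)] distinct_card[OF xs(1)] card_V by simp
  then have R: "R = []" "length xs = 10" using xs by auto
  then have "set xs = V" using xs card_V finite_V distinct_card[OF xs(1)] by (intro card_subset_eq) auto
  with s(1) D R show ?thesis
    by (intro exI[of _ "(D', R')"] exI[of _ D] exI[of _ xs]) (auto simp: explored_def)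
qed

end

section \<open>Graphs realising adjacency lists\<close>

text \<open>A numbering of the vertices under which \<open>L\<close> is the adjacency list. As
  \<open>L\<close> does not mention the vertex type, it serves as a common reference for graphs over
  different types.\<close>

definition realises :: "'a pair_pre_digraph \<Rightarrow> 'a list \<Rightarrow> nat list list \<Rightarrow> bool" where
  "realises G xs L \<longleftrightarrow> distinct xs \<and> set xs = pverts G \<and> length L = length xs \<and>
     (\<forall>i<length xs. \<forall>j<length xs. (xs ! i, xs ! j) \<in> parcs G \<longleftrightarrow> j \<in> set (L ! i))"

lemma pair_graph_arc_verts: "pair_graph G \<Longrightarrow> (u, v) \<in> parcs G \<Longrightarrow> u \<in> pverts G \<and> v \<in> pverts G"
  using pair_wf_digraph.arc_fst_in_verts pair_wf_digraph.arc_snd_in_verts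
  by (fastforce simp: pair_graph_def pair_digraph_def pair_fin_digraph_def)

lemma realises_isomorphic:
  assumes G: "pair_graph G" "realises G xs L" and H: "pair_graph H" "realises H ys L"
  shows "isomorphic G H"
proof -
  define f where "f x = ys ! the_inv_into {..<length xs} ((!) xs) x" for x
  have len: "length xs = length ys" using G H by (simp add: realises_def)
  have inj: "inj_on ((!) xs) {..<length xs}" using G by (auto simp: realises_def inj_on_nth)
  have f: "f (xs ! i) = ys ! i" if "i < length xs" for i
    using the_inv_into_f_f[OF inj, of i] that by (simp add: f_def)
  have GV: "pverts G = (!) xs ` {..<length xs}" and HV: "pverts H = (!) ys ` {..<length ys}"
    using G H by (auto simp: realises_def set_conv_nth)
  have injf: "inj_on f (pverts G)"
    using H len by (auto simp: GV inj_on_def f realises_def nth_eq_iff_index_eq)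
  have fV: "pverts H = f ` pverts G" unfolding GV HV image_image using len by (auto simp: f)
  have arc: "(f u, f v) \<in> parcs H \<longleftrightarrow> (u, v) \<in> parcs G" if "u \<in> pverts G" "v \<in> pverts G" for u v
    using that G H len by (auto simp: GV f realises_def)
  have arcs: "parcs H = map_prod f f ` parcs G"
  proof (intro equalityI subsetI)
    fix e assume e: "e \<in> parcs H"
    obtain a b where ab: "e = (a, b)" by (cases e)
    with e have "a \<in> pverts H" "b \<in> pverts H" using pair_graph_arc_verts[OF H(1)] by auto
    then obtain u v where "u \<in> pverts G" "v \<in> pverts G" "a = f u" "b = f v" unfolding fV by auto
    then show "e \<in> map_prod f f ` parcs G" using e arc ab by force
  next
    fix e assume "e \<in> map_prod f f ` parcs G"
    then show "e \<in> parcs H" using arc pair_graph_arc_verts[OF G(1)] by auto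
  qed
  \<comment> \<open>The library notion of isomorphism also renames arcs and replaces the head and
    tail maps. Arcs here are pairs, so the last two remain the projections.\<close>
  let ?h = "\<lparr>iso_verts = f, iso_arcs = map_prod f f, iso_head = snd, iso_tail = fst\<rparr>"
  have "parcs G \<subseteq> pverts G \<times> pverts G" using pair_graph_arc_verts[OF G(1)] by auto
  then have "inj_on (map_prod f f) (parcs G)"
    using map_prod_inj_on[OF injf injf] inj_on_subset by blast
  moreover have "wf_digraph (with_proj G)"
    using G(1) by (simp add: wf_digraph_wp_iff pair_graph_def pair_digraph_def pair_fin_digraph_def)
  ultimately have "pre_digraph.digraph_isomorphism (with_proj G) ?h"
    using injf by (simp add: pre_digraph.digraph_isomorphism_def)
  moreover have "with_proj H = app_iso ?h (with_proj G)"
    by (simp add: with_proj_def app_iso_def fV arcs)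
  ultimately show ?thesis unfolding isomorphic_def digraph_iso_def by blast
qed

lemma isomorphic_realises:
  assumes iso: "isomorphic G H" and G: "pair_graph G" "realises G xs L"
  shows "\<exists>ys. realises H ys L"
proof -
  from iso obtain h where h: "pre_digraph.digraph_isomorphism (with_proj G) h"
    and H: "with_proj H = app_iso h (with_proj G)"
    by (auto simp: isomorphic_def digraph_iso_def)
  let ?f = "iso_verts h"
  have inj: "inj_on ?f (pverts G)"
    and tails: "\<And>e. e \<in> parcs G \<Longrightarrow> iso_tail h (iso_arcs h e) = ?f (fst e)"
    and heads: "\<And>e. e \<in> parcs G \<Longrightarrow> iso_head h (iso_arcs h e) = ?f (snd e)"
    using h by (auto simp: pre_digraph.digraph_isomorphism_def)
  have V: "pverts H = ?f ` pverts G" and E: "parcs H = iso_arcs h ` parcs G"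
    and "fst = iso_tail h" "snd = iso_head h"
    using H by (auto simp: with_proj_def app_iso_def)
  \<comment> \<open>Both graphs use the projections as tail and head, which forces
    \<open>iso_tail h = fst\<close> and \<open>iso_head h = snd\<close>. Hence the image of an arc
    is determined by the images of its end vertices.\<close>
  then have arcs: "parcs H = (\<lambda>e. (?f (fst e), ?f (snd e))) ` parcs G"
    using tails heads by (metis (no_types, lifting) image_cong prod.collapse)
  have arc: "(?f u, ?f v) \<in> parcs H \<longleftrightarrow> (u, v) \<in> parcs G" if "u \<in> pverts G" "v \<in> pverts G" for u v
  proof
    assume "(?f u, ?f v) \<in> parcs H"
    then obtain a b where ab: "(a, b) \<in> parcs G" "?f u = ?f a" "?f v = ?f b" unfolding arcs by auto
    then have "u = a" "v = b" using that inj pair_graph_arc_verts[OF G(1) ab(1)] by (auto dest: inj_onD)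
    with ab show "(u, v) \<in> parcs G" by simp
  next
    assume "(u, v) \<in> parcs G"
    then show "(?f u, ?f v) \<in> parcs H" unfolding arcs by force
  qed
  have "realises H (map ?f xs) L"
    using G(2) inj arc nth_mem[of _ xs] by (auto simp: realises_def V distinct_map)
  then show ?thesis ..
qed

text \<open>The listing chosen by \<open>vertex_list\<close> is a permutation of \<open>xs\<close>,
  and permuting rows and columns alike keeps the characteristic polynomial. Here the dependence on
  the choice disappears.\<close>

lemma realises_char_poly:
  assumes G: "realises G xs L"
  shows "char_poly (adjacency_matrix G) = char_poly (rows_matrix L)"
proof -
  let ?n = "length xs"
  have "\<exists>vs. distinct vs \<and> set vs = pverts G" using G by (auto simp: realises_def)
  then have vs: "distinct (vertex_list G)" "set (vertex_list G) = pverts G"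
    unfolding vertex_list_def by (rule someI2_ex, simp)+
  then have "mset (vertex_list G) = mset xs"
    using G by (simp add: realises_def set_eq_iff_mset_eq_distinct[symmetric])
  then obtain p where p: "p permutes {..<?n}" "permute_list p xs = vertex_list G"
    by (rule mset_eq_permutation)
  have card: "card (pverts G) = ?n" using G distinct_card[of xs] by (auto simp: realises_def)
  have L: "length L = ?n" using G by (simp add: realises_def)
  have "p i < ?n" if "i < ?n" for i using permutes_in_image[OF p(1), of i] that by simp
  then have "adjacency_matrix G = mat ?n ?n (\<lambda>(i, j). rows_matrix L $$ (p i, p j))"
    unfolding adjacency_matrix_def card Let_def p(2)[symmetric]
    using G L by (intro eq_matI) (auto simp: permute_list_nth[OF p(1)] rows_matrix_def realises_def)
  moreover have "rows_matrix L \<in> carrier_mat ?n ?n" by (simp add: rows_matrix_def L)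
  moreover have "p permutes {0..<?n}" using p(1) by (simp add: lessThan_atLeast0)
  ultimately show ?thesis by (simp add: char_poly_permute)
qed

lemma randic_matrix_cubic:
  assumes "G \<in> cubic_graphs n"
  shows "randic_matrix G = (1 / 3) \<cdot>\<^sub>m adjacency_matrix G"
proof -
  have fin: "finite (pverts G)"
    using assms by (auto simp: cubic_graphs_def pair_graph_def pair_digraph_def dest: pair_fin_digraph.pair_finite_verts)
  have "\<exists>vs. distinct vs \<and> set vs = pverts G" using finite_distinct_list[OF fin] by blast
  then have vs: "distinct (vertex_list G)" "set (vertex_list G) = pverts G"
    unfolding vertex_list_def by (rule someI2_ex, simp)+
  then have "length (vertex_list G) = card (pverts G)" using distinct_card by metis
  then have "degree_of G (vertex_list G ! i) = 3" if "i < card (pverts G)" for i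
    using assms vs that nth_mem[of i "vertex_list G"] by (auto simp: cubic_graphs_def)
  then show ?thesis
    unfolding randic_matrix_def adjacency_matrix_def Let_def
    by (intro eq_matI) auto
qed

lemma card_out_neighbours:
  "degree_of G v = card {w. (v, w) \<in> parcs G}"
proof -
  have "out_arcs (with_proj G) v = Pair v ` {w. (v, w) \<in> parcs G}" by (auto simp: out_arcs_def)
  then show ?thesis by (simp add: degree_of_def out_degree_def card_image inj_on_def)
qed

section \<open>The 21 cubic graphs of order 10\<close>

text \<open>The representatives, in the order of increasing energy.\<close>

definition graphs :: "nat list list list" where
  "graphs = [
    [[1,2,3],[0,4,5],[0,4,5],[0,4,5],[3,2,1],[3,2,1],[7,8,9],[6,8,9],[7,6,9],[8,7,6]],
    [[1,2,3],[0,4,5],[0,6,7],[0,6,7],[1,5,8],[4,1,8],[3,2,9],[3,2,9],[5,4,9],[8,7,6]],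
    [[1,2,3],[0,4,5],[0,6,7],[0,6,7],[1,8,9],[1,8,9],[3,2,7],[6,3,2],[5,4,9],[8,5,4]],
    [[1,2,3],[0,4,5],[0,3,5],[2,0,4],[3,1,5],[4,2,1],[7,8,9],[6,8,9],[7,6,9],[8,7,6]],
    [[1,2,3],[0,4,5],[0,6,7],[0,6,7],[1,8,9],[1,8,9],[3,2,9],[3,2,8],[7,5,4],[6,5,4]],
    [[1,2,3],[0,4,5],[0,3,6],[2,0,7],[1,5,8],[4,1,8],[2,7,9],[6,3,9],[5,4,9],[8,7,6]],
    [[1,2,3],[0,4,5],[0,6,7],[0,7,8],[1,8,9],[1,8,9],[2,7,9],[6,3,2],[5,4,3],[6,5,4]],
    [[1,2,3],[0,4,5],[0,6,7],[0,5,7],[1,6,8],[3,1,8],[4,2,9],[3,2,9],[5,4,9],[8,7,6]],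
    [[1,2,3],[0,4,5],[0,6,7],[0,5,7],[1,8,9],[3,1,9],[2,7,8],[6,3,2],[6,4,9],[8,5,4]],
    [[1,2,3],[0,4,5],[0,6,7],[0,7,8],[1,5,8],[4,1,6],[5,2,9],[3,2,9],[4,3,9],[8,7,6]],
    [[1,2,3],[0,4,5],[0,6,7],[0,7,8],[1,5,9],[4,1,9],[2,8,9],[3,2,8],[7,6,3],[6,5,4]],
    [[1,2,3],[0,4,5],[0,6,7],[0,7,8],[1,8,9],[1,6,9],[5,2,9],[3,2,8],[7,4,3],[6,5,4]],
    [[1,2,3],[0,4,5],[0,6,7],[0,5,7],[1,8,9],[3,1,9],[2,8,9],[3,2,8],[7,6,4],[6,5,4]],
    [[1,2,3],[0,4,5],[0,6,7],[0,7,8],[1,8,9],[1,7,9],[2,8,9],[5,3,2],[6,4,3],[6,5,4]],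
    [[1,2,3],[0,4,5],[0,6,7],[0,8,9],[1,8,9],[1,6,7],[5,2,9],[5,2,8],[7,4,3],[6,4,3]],
    [[1,2,3],[0,4,5],[0,6,7],[0,8,9],[1,8,9],[1,6,7],[5,2,7],[6,5,2],[4,3,9],[8,4,3]],
    [[1,2,3],[0,4,5],[0,6,7],[0,8,9],[1,8,9],[1,7,9],[2,7,8],[6,5,2],[6,4,3],[5,4,3]],
    [[1,2,3],[0,4,5],[0,6,7],[0,8,9],[1,5,9],[4,1,7],[2,7,8],[6,5,2],[6,3,9],[8,4,3]],
    [[1,2,3],[0,4,5],[0,6,7],[0,7,8],[1,5,9],[4,1,7],[2,8,9],[5,3,2],[6,3,9],[8,6,4]],
    [[1,2,3],[0,4,5],[0,6,7],[0,8,9],[1,7,9],[1,6,8],[5,2,8],[4,2,9],[6,5,3],[7,4,3]],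
    [[1,2,3],[0,4,5],[0,6,7],[0,8,9],[1,7,9],[1,6,8],[5,2,9],[4,2,8],[7,5,3],[6,4,3]]]"

text \<open>For each representative, the factors of the characteristic polynomial with isolating intervals of their
  roots.\<close>

definition spectra :: "(int list \<times> (int \<times> int) list) list list" where
  "spectra = [
    [([3,1],[(-3001,-2999)]), ([1,1],[(-1001,-999)]), ([1,1],[(-1001,-999)]), ([1,1],[(-1001,-999)]),
     ([0,1],[(-1,1)]), ([0,1],[(-1,1)]), ([0,1],[(-1,1)]), ([0,1],[(-1,1)]), ([-3,1],[(2999,3001)]),
     ([-3,1],[(2999,3001)])],
    [([2,1],[(-2001,-1999)]), ([1,1],[(-1001,-999)]), ([0,1],[(-1,1)]), ([0,1],[(-1,1)]),
     ([-3,1],[(2999,3001)]), ([-1,-2,1],[(-415,-414),(2414,2415)]),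
     ([-2,-3,2,1],[(-2814,-2813),(-530,-529),(1342,1343)])],
    [([2,1],[(-2001,-1999)]), ([1,1],[(-1001,-999)]), ([1,1],[(-1001,-999)]), ([0,1],[(-1,1)]),
     ([0,1],[(-1,1)]), ([-1,1],[(999,1001)]), ([-3,1],[(2999,3001)]),
     ([-2,-7,0,1],[(-2490,-2489),(-290,-289),(2778,2779)])],
    [([2,1],[(-2001,-1999)]), ([2,1],[(-2001,-1999)]), ([1,1],[(-1001,-999)]), ([1,1],[(-1001,-999)]),
     ([1,1],[(-1001,-999)]), ([0,1],[(-1,1)]), ([0,1],[(-1,1)]), ([-1,1],[(999,1001)]),
     ([-3,1],[(2999,3001)]), ([-3,1],[(2999,3001)])],
    [([3,1],[(-3001,-2999)]), ([2,1],[(-2001,-1999)]), ([1,1],[(-1001,-999)]), ([1,1],[(-1001,-999)]),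
     ([0,1],[(-1,1)]), ([0,1],[(-1,1)]), ([-1,1],[(999,1001)]), ([-1,1],[(999,1001)]),
     ([-2,1],[(1999,2001)]), ([-3,1],[(2999,3001)])],
    [([2,1],[(-2001,-1999)]), ([2,1],[(-2001,-1999)]), ([1,1],[(-1001,-999)]), ([0,1],[(-1,1)]),
     ([0,1],[(-1,1)]), ([-3,1],[(2999,3001)]), ([-1,-2,1],[(-415,-414),(2414,2415)]),
     ([-3,0,1],[(-1733,-1732),(1732,1733)])],
    [([0,1],[(-1,1)]), ([-3,1],[(2999,3001)]), ([-1,-1,2,1],[(-2247,-2246),(-555,-554),(801,802)]),
     ([4,9,-4,-7,1,1],[(-2667,-2666),(-1295,-1294),(-427,-426),(1309,1310),(2077,2078)])],
    [([-1,1],[(999,1001)]), ([-3,1],[(2999,3001)]), ([-1,-1,1],[(-619,-618),(1618,1619)]),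
     ([1,3,1],[(-2619,-2618),(-382,-381)]), ([-1,-1,1],[(-619,-618),(1618,1619)]),
     ([1,3,1],[(-2619,-2618),(-382,-381)])],
    [([-3,1],[(2999,3001)]), ([-1,-1,1],[(-619,-618),(1618,1619)]), ([-1,1,1],[(-1619,-1618),(618,619)]),
     ([1,3,1],[(-2619,-2618),(-382,-381)]), ([-1,-4,0,1],[(-1861,-1860),(-255,-254),(2114,2115)])],
    [([-3,1],[(2999,3001)]), ([-1,-5,1,1],[(-2710,-2709),(-194,-193),(1903,1904)]),
     ([-1,-2,1,1],[(-1802,-1801),(-446,-445),(1246,1247)]),
     ([-1,-2,1,1],[(-1802,-1801),(-446,-445),(1246,1247)])],
    [([1,1],[(-1001,-999)]), ([-3,1],[(2999,3001)]),
     ([-1,-2,1,1],[(-1802,-1801),(-446,-445),(1246,1247)]),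
     ([1,6,-6,-7,1,1],[(-2481,-2480),(-1535,-1534),(-149,-148),(725,726),(2438,2439)])],
    [([2,1],[(-2001,-1999)]), ([1,1],[(-1001,-999)]), ([0,1],[(-1,1)]), ([-1,1],[(999,1001)]),
     ([-3,1],[(2999,3001)]),
     ([4,10,-5,-7,1,1],[(-2457,-2456),(-1606,-1605),(-369,-368),(1283,1284),(2146,2147)])],
    [([3,1],[(-3001,-2999)]), ([-3,1],[(2999,3001)]), ([-1,-1,1],[(-619,-618),(1618,1619)]),
     ([-1,1,1],[(-1619,-1618),(618,619)]), ([-1,-1,1],[(-619,-618),(1618,1619)]),
     ([-1,1,1],[(-1619,-1618),(618,619)])],
    [([-1,1],[(999,1001)]), ([-3,1],[(2999,3001)]), ([-1,-1,1],[(-619,-618),(1618,1619)]),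
     ([-3,1,1],[(-2303,-2302),(1302,1303)]), ([-1,1,1],[(-1619,-1618),(618,619)]),
     ([1,3,1],[(-2619,-2618),(-382,-381)])],
    [([2,1],[(-2001,-1999)]), ([2,1],[(-2001,-1999)]), ([1,1],[(-1001,-999)]), ([0,1],[(-1,1)]),
     ([-1,1],[(999,1001)]), ([-1,1],[(999,1001)]), ([-1,1],[(999,1001)]), ([-3,1],[(2999,3001)]),
     ([-4,1,1],[(-2562,-2561),(1561,1562)])],
    [([2,1],[(-2001,-1999)]), ([2,1],[(-2001,-1999)]), ([1,1],[(-1001,-999)]), ([1,1],[(-1001,-999)]),
     ([0,1],[(-1,1)]), ([-1,1],[(999,1001)]), ([-1,1],[(999,1001)]), ([-3,1],[(2999,3001)]),
     ([-4,-1,1],[(-1562,-1561),(2561,2562)])],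
    [([2,1],[(-2001,-1999)]), ([-1,1],[(999,1001)]), ([-3,1],[(2999,3001)]),
     ([-1,-3,0,1],[(-1533,-1532),(-348,-347),(1879,1880)]),
     ([2,-3,-3,2,1],[(-2597,-2596),(-1183,-1182),(515,516),(1263,1264)])],
    [([2,1],[(-2001,-1999)]), ([2,1],[(-2001,-1999)]), ([-1,1],[(999,1001)]), ([-3,1],[(2999,3001)]),
     ([-1,-3,0,1],[(-1533,-1532),(-348,-347),(1879,1880)]),
     ([-1,-3,0,1],[(-1533,-1532),(-348,-347),(1879,1880)])],
    [([-3,1],[(2999,3001)]), ([-1,-1,1],[(-619,-618),(1618,1619)]), ([-1,1,1],[(-1619,-1618),(618,619)]),
     ([-1,1,1],[(-1619,-1618),(618,619)]), ([-7,-4,2,1],[(-2473,-2472),(-1463,-1462),(1935,1936)])],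
    [([2,1],[(-2001,-1999)]), ([2,1],[(-2001,-1999)]), ([2,1],[(-2001,-1999)]), ([1,1],[(-1001,-999)]),
     ([1,1],[(-1001,-999)]), ([-1,1],[(999,1001)]), ([-1,1],[(999,1001)]), ([-1,1],[(999,1001)]),
     ([-2,1],[(1999,2001)]), ([-3,1],[(2999,3001)])],
    [([2,1],[(-2001,-1999)]), ([2,1],[(-2001,-1999)]), ([2,1],[(-2001,-1999)]), ([2,1],[(-2001,-1999)]),
     ([-1,1],[(999,1001)]), ([-1,1],[(999,1001)]), ([-1,1],[(999,1001)]), ([-1,1],[(999,1001)]),
     ([-1,1],[(999,1001)]), ([-3,1],[(2999,3001)])]]"

text \<open>For each of the 222 states of \<open>descend 0 5 [([], [])]\<close> and each of its completions, in this order, the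
  index \<open>k\<close> of the representative and the list \<open>q\<close> such that vertex \<open>i\<close> of the representative corresponds
  to vertex \<open>q ! i\<close> of the completion.\<close>

definition leaf_isos :: "(nat \<times> nat list) list list" where
  "leaf_isos = [
    [(16,[0,1,2,3,4,5,6,7,8,9]), (16,[0,1,2,3,4,5,6,7,9,8]), (16,[0,1,2,3,4,5,7,6,8,9]),
    (16,[0,1,2,3,4,5,7,6,9,8]), (14,[0,1,2,3,4,5,6,7,8,9]), (14,[0,1,2,3,4,5,6,7,9,8]),
    (15,[0,1,2,3,4,5,6,7,8,9])], [(16,[0,1,2,3,5,4,6,7,8,9]), (14,[0,2,1,3,6,7,4,5,8,9]),
    (14,[0,3,1,2,8,9,4,5,6,7]), (20,[0,1,2,3,4,5,6,7,8,9]), (19,[0,1,2,3,4,5,6,7,8,9]),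
    (19,[1,0,4,5,2,3,9,7,8,6]), (16,[0,1,3,2,5,4,8,9,6,7])], [(16,[0,1,2,3,5,4,6,7,9,8]),
    (14,[0,2,1,3,6,7,4,5,9,8]), (19,[0,1,2,3,4,5,6,7,9,8]), (20,[0,1,2,3,4,5,6,7,9,8]),
    (19,[1,0,4,5,2,3,8,7,9,6]), (14,[0,3,1,2,9,8,4,5,6,7]), (16,[0,1,3,2,5,4,9,8,6,7])],
    [(16,[0,1,2,3,5,4,7,6,8,9]), (14,[0,3,1,2,8,9,4,5,7,6]), (19,[0,1,2,3,4,5,7,6,8,9]),
    (20,[0,1,2,3,4,5,7,6,8,9]), (19,[1,0,4,5,2,3,9,6,8,7]), (14,[0,2,1,3,7,6,4,5,8,9]),
    (16,[0,1,3,2,5,4,8,9,7,6])], [(16,[0,1,2,3,5,4,7,6,9,8]), (20,[0,1,2,3,4,5,7,6,9,8]),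
    (19,[0,1,2,3,4,5,7,6,9,8]), (19,[1,0,4,5,2,3,8,6,9,7]), (14,[0,3,1,2,9,8,4,5,7,6]),
    (14,[0,2,1,3,7,6,4,5,9,8]), (16,[0,1,3,2,5,4,9,8,7,6])], [(14,[0,1,2,3,5,4,6,7,8,9]),
    (14,[0,1,2,3,5,4,6,7,9,8]), (15,[0,1,2,3,5,4,6,7,8,9]), (16,[0,1,3,2,4,5,8,9,6,7]),
    (16,[0,1,3,2,4,5,9,8,6,7]), (16,[0,1,3,2,4,5,8,9,7,6]), (16,[0,1,3,2,4,5,9,8,7,6])],
    [(15,[0,3,1,2,8,9,4,5,6,7]), (19,[3,0,8,9,1,2,7,5,6,4]), (19,[3,0,8,9,1,2,6,5,7,4]),
    (16,[0,2,1,3,6,7,4,5,9,8]), (17,[0,1,2,3,4,5,6,7,8,9]), (16,[0,2,1,3,7,6,4,5,9,8]),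
    (17,[0,1,2,3,4,5,7,6,8,9])], [(19,[3,0,8,9,1,2,7,4,6,5]), (19,[3,0,8,9,1,2,6,4,7,5]),
    (15,[0,3,1,2,9,8,4,5,6,7]), (16,[0,2,1,3,6,7,4,5,8,9]), (17,[0,1,2,3,4,5,6,7,9,8]),
    (16,[0,2,1,3,7,6,4,5,8,9]), (17,[0,1,2,3,4,5,7,6,9,8])], [(16,[0,2,1,3,6,7,5,4,9,8]),
    (17,[0,1,2,3,5,4,6,7,8,9]), (16,[0,2,1,3,6,7,5,4,8,9]), (17,[0,1,2,3,5,4,6,7,9,8]),
    (15,[0,2,1,3,6,7,4,5,8,9]), (19,[2,0,6,7,1,3,9,5,8,4]), (19,[2,0,6,7,1,3,8,5,9,4])],
    [(16,[0,2,1,3,7,6,5,4,9,8]), (17,[0,1,2,3,5,4,7,6,8,9]), (16,[0,2,1,3,7,6,5,4,8,9]),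
    (17,[0,1,2,3,5,4,7,6,9,8]), (19,[2,0,6,7,1,3,9,4,8,5]), (19,[2,0,6,7,1,3,8,4,9,5]),
    (15,[0,2,1,3,7,6,4,5,8,9])], [(6,[0,1,2,3,4,5,6,7,8,9]), (13,[0,1,2,3,4,5,6,7,8,9]),
    (11,[0,1,2,3,4,5,6,7,8,9]), (14,[6,8,2,5,4,3,0,7,9,1]), (11,[0,1,3,2,5,4,8,7,6,9]),
    (13,[1,0,4,5,2,3,9,8,6,7]), (16,[1,0,4,5,2,3,9,8,6,7])], [(13,[0,1,2,3,5,4,6,7,8,9]),
    (13,[0,1,3,2,5,4,8,7,6,9]), (14,[1,4,0,5,9,7,2,3,8,6])], [(16,[1,0,5,4,3,2,9,6,8,7])],
    [(11,[0,1,2,3,5,4,6,7,8,9]), (14,[6,8,2,4,5,3,0,7,9,1]), (11,[0,1,3,2,4,5,8,7,6,9]),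
    (13,[0,1,3,2,4,5,8,7,6,9]), (16,[1,0,4,5,3,2,9,6,8,7]), (6,[0,1,3,2,4,5,8,7,6,9]),
    (13,[1,0,4,5,3,2,9,6,8,7])], [(13,[1,0,5,4,2,3,9,8,6,7]), (14,[1,5,0,4,9,7,2,3,8,6]),
    (13,[1,0,5,4,3,2,9,6,8,7])], [(16,[1,0,5,4,2,3,9,8,6,7])], [(10,[0,1,2,3,4,5,6,7,8,9]),
    (10,[0,1,3,2,4,5,8,7,6,9]), (16,[8,3,5,6,7,0,4,1,9,2]), (11,[3,8,0,7,9,5,1,2,6,4]),
    (18,[0,1,2,3,4,5,6,7,8,9]), (11,[2,6,0,7,9,5,1,3,8,4]), (16,[6,2,5,8,7,0,4,1,9,3])],
    [(16,[8,3,4,6,7,0,5,1,9,2]), (11,[3,8,0,7,9,4,1,2,6,5]), (9,[0,1,2,3,4,5,6,7,8,9])],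
    [(18,[0,1,2,3,5,4,6,7,8,9])], [(11,[2,6,0,7,9,4,1,3,8,5]), (16,[6,2,4,8,7,0,5,1,9,3]),
    (9,[0,1,2,3,5,4,6,7,8,9])], [(6,[0,1,2,3,4,5,7,6,8,9]), (14,[7,8,2,5,4,3,0,6,9,1]),
    (11,[0,1,2,3,4,5,7,6,8,9]), (11,[0,1,3,2,5,4,8,6,7,9]), (13,[1,0,4,5,2,3,9,8,7,6]),
    (13,[0,1,2,3,4,5,7,6,8,9]), (16,[1,0,4,5,2,3,9,8,7,6])], [(14,[7,8,2,4,5,3,0,6,9,1]),
    (11,[0,1,2,3,5,4,7,6,8,9]), (11,[0,1,3,2,4,5,8,6,7,9]), (6,[0,1,3,2,4,5,8,6,7,9]),
    (13,[1,0,4,5,3,2,9,7,8,6]), (13,[0,1,3,2,4,5,8,6,7,9]), (16,[1,0,4,5,3,2,9,7,8,6])],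
    [(13,[1,0,5,4,2,3,9,8,7,6]), (13,[1,0,5,4,3,2,9,7,8,6]), (14,[1,5,0,4,9,6,2,3,8,7])],
    [(13,[0,1,2,3,5,4,7,6,8,9]), (13,[0,1,3,2,5,4,8,6,7,9]), (14,[1,4,0,5,9,6,2,3,8,7])],
    [(16,[1,0,5,4,3,2,9,7,8,6])], [(16,[1,0,5,4,2,3,9,8,7,6])], [(10,[0,1,2,3,4,5,7,6,8,9]),
    (10,[0,1,3,2,4,5,8,6,7,9]), (16,[8,3,5,7,6,0,4,1,9,2]), (11,[3,8,0,6,9,5,1,2,7,4]),
    (16,[7,2,5,8,6,0,4,1,9,3]), (11,[2,7,0,6,9,5,1,3,8,4]), (18,[0,1,2,3,4,5,7,6,8,9])],
    [(16,[8,3,4,7,6,0,5,1,9,2]), (11,[3,8,0,6,9,4,1,2,7,5]), (9,[0,1,2,3,4,5,7,6,8,9])],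
    [(16,[7,2,4,8,6,0,5,1,9,3]), (11,[2,7,0,6,9,4,1,3,8,5]), (9,[0,1,2,3,5,4,7,6,8,9])],
    [(18,[0,1,2,3,5,4,7,6,8,9])], [(4,[0,1,2,3,4,5,6,7,8,9]), (4,[0,1,2,3,4,5,6,7,9,8]),
    (2,[0,1,2,3,4,5,6,7,8,9]), (6,[1,0,4,5,2,3,8,9,7,6]), (6,[1,0,4,5,2,3,9,8,7,6]),
    (6,[1,0,4,5,2,3,8,9,6,7]), (6,[1,0,4,5,2,3,9,8,6,7])], [(6,[1,0,5,4,2,3,9,8,7,6])],
    [(6,[1,0,5,4,2,3,9,8,6,7])], [], [(6,[8,7,4,9,2,3,1,5,6,0]), (6,[8,6,4,9,2,3,1,5,7,0]),
    (1,[0,1,2,3,4,5,6,7,8,9])], [], [], [(16,[8,3,7,4,5,0,6,2,9,1]), (16,[8,3,6,4,5,0,7,2,9,1]),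
    (10,[0,2,1,3,6,7,4,5,8,9]), (13,[0,2,1,3,6,7,4,5,8,9]), (18,[0,2,1,3,6,7,4,5,8,9]),
    (13,[0,2,1,3,7,6,4,5,8,9]), (18,[0,2,1,3,7,6,4,5,8,9])], [(13,[2,0,6,7,1,3,9,8,4,5]),
    (9,[0,2,1,3,6,7,4,5,8,9]), (11,[0,2,1,3,6,7,4,5,8,9]), (11,[1,4,0,5,9,7,2,3,8,6]),
    (16,[2,0,6,7,1,3,9,8,4,5]), (14,[2,6,0,7,9,5,1,3,8,4]), (16,[2,0,7,6,3,1,9,4,8,5])],
    [(14,[4,8,1,7,6,3,0,5,9,2]), (16,[4,1,7,8,5,0,6,2,9,3]), (13,[0,2,3,1,7,6,8,5,4,9])],
    [(13,[2,0,7,6,1,3,9,8,4,5]), (9,[0,2,1,3,7,6,4,5,8,9]), (11,[0,2,1,3,7,6,4,5,8,9]),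
    (11,[1,4,0,5,9,6,2,3,8,7]), (16,[2,0,6,7,3,1,9,4,8,5]), (14,[2,7,0,6,9,5,1,3,8,4]),
    (16,[2,0,7,6,1,3,9,8,4,5])], [(14,[4,8,1,6,7,3,0,5,9,2]), (16,[4,1,6,8,5,0,7,2,9,3]),
    (13,[0,2,3,1,6,7,8,5,4,9])], [(13,[2,0,6,7,3,1,9,4,8,5]), (13,[2,0,7,6,3,1,9,4,8,5]),
    (6,[0,2,3,1,6,7,8,5,4,9])], [(6,[0,2,1,3,6,7,4,5,8,9]), (11,[3,8,0,5,9,7,2,1,4,6]),
    (11,[3,8,0,5,9,6,2,1,4,7])], [(10,[0,2,3,1,6,7,8,5,4,9])], [(11,[0,2,3,1,7,6,8,5,4,9])],
    [(11,[0,2,3,1,6,7,8,5,4,9])], [(12,[0,1,2,3,4,5,6,7,8,9]), (8,[0,1,2,3,4,5,6,7,8,9]),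
    (12,[0,1,2,3,4,5,6,7,9,8]), (8,[0,1,2,3,4,5,6,7,9,8]), (10,[1,4,0,5,8,9,2,3,7,6]),
    (16,[6,2,9,5,0,7,4,8,1,3]), (16,[6,2,8,5,0,7,4,9,1,3])], [(16,[4,1,8,7,0,5,6,9,2,3])],
    [(13,[4,1,8,6,0,5,7,9,2,3]), (9,[1,4,0,5,8,6,2,3,9,7]), (7,[0,1,2,3,4,5,6,7,8,9])], [],
    [(8,[0,2,1,3,6,7,4,5,8,9])], [], [], [(12,[0,1,2,3,4,5,7,6,8,9]), (8,[0,1,2,3,4,5,7,6,8,9]),
    (12,[0,1,2,3,4,5,7,6,9,8]), (8,[0,1,2,3,4,5,7,6,9,8]), (16,[7,2,8,5,0,6,4,9,1,3]),
    (16,[7,2,9,5,0,6,4,8,1,3]), (10,[1,4,0,5,8,9,2,3,6,7])], [(9,[1,4,0,5,8,7,2,3,9,6]),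
    (13,[4,1,8,7,0,5,6,9,2,3]), (7,[0,1,2,3,4,5,7,6,8,9])], [(16,[4,1,8,6,0,5,7,9,2,3])], [],
    [(8,[0,2,1,3,7,6,4,5,8,9])], [], [], [(16,[8,3,7,5,4,0,6,2,9,1]), (16,[8,3,6,5,4,0,7,2,9,1]),
    (13,[2,0,6,7,1,3,9,8,5,4]), (9,[0,2,1,3,6,7,5,4,8,9]), (14,[5,8,1,7,6,3,0,4,9,2]),
    (16,[5,1,7,8,4,0,6,2,9,3]), (13,[2,0,7,6,1,3,9,8,5,4]), (9,[0,2,1,3,7,6,5,4,8,9]),
    (14,[5,8,1,6,7,3,0,4,9,2]), (16,[5,1,6,8,4,0,7,2,9,3]), (13,[2,0,6,7,3,1,9,5,8,4]),
    (13,[2,0,7,6,3,1,9,5,8,4])], [(10,[0,2,1,3,6,7,5,4,8,9]), (11,[0,2,1,3,6,7,5,4,8,9]),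
    (11,[1,5,0,4,9,7,2,3,8,6]), (11,[0,2,1,3,7,6,5,4,8,9]), (11,[1,5,0,4,9,6,2,3,8,7]),
    (6,[0,2,3,1,6,7,8,4,5,9])], [(13,[0,2,1,3,6,7,5,4,8,9]), (18,[0,2,1,3,6,7,5,4,8,9]),
    (16,[2,0,6,7,1,3,9,8,5,4]), (16,[2,0,6,7,3,1,9,5,8,4]), (14,[2,7,0,6,9,4,1,3,8,5]),
    (13,[0,2,3,1,6,7,8,4,5,9])], [(13,[0,2,1,3,7,6,5,4,8,9]), (18,[0,2,1,3,7,6,5,4,8,9]),
    (14,[2,6,0,7,9,4,1,3,8,5]), (16,[2,0,7,6,3,1,9,5,8,4]), (13,[0,2,3,1,7,6,8,4,5,9]),
    (16,[2,0,7,6,1,3,9,8,5,4])], [(6,[0,2,1,3,6,7,5,4,8,9]), (11,[3,8,0,4,9,7,2,1,5,6]),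
    (11,[3,8,0,4,9,6,2,1,5,7]), (10,[0,2,3,1,6,7,8,4,5,9]), (11,[0,2,3,1,7,6,8,4,5,9]),
    (11,[0,2,3,1,6,7,8,4,5,9])], [(12,[0,1,2,3,5,4,6,7,9,8]), (8,[0,1,2,3,5,4,6,7,9,8]),
    (16,[5,1,9,7,0,4,6,8,2,3]), (9,[1,5,0,4,9,6,2,3,8,7]), (13,[5,1,9,6,0,4,7,8,2,3]),
    (7,[0,1,2,3,5,4,6,7,8,9])], [(10,[1,5,0,4,8,9,2,3,7,6])], [(16,[6,2,9,4,0,7,5,8,1,3]),
    (16,[6,2,8,4,0,7,5,9,1,3])], [(8,[0,2,1,3,6,7,5,4,8,9])], [(12,[0,1,2,3,5,4,7,6,9,8]),
    (8,[0,1,2,3,5,4,7,6,9,8]), (13,[5,1,9,7,0,4,6,8,2,3]), (9,[1,5,0,4,9,7,2,3,8,6]),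
    (7,[0,1,2,3,5,4,7,6,8,9]), (16,[5,1,9,6,0,4,7,8,2,3])], [(16,[7,2,8,4,0,6,5,9,1,3]),
    (16,[7,2,9,4,0,6,5,8,1,3])], [(10,[1,5,0,4,8,9,2,3,6,7])], [(8,[0,2,1,3,7,6,5,4,8,9])],
    [(4,[0,2,1,3,6,7,4,5,9,8]), (6,[8,4,7,9,1,3,2,6,5,0]), (6,[8,4,6,9,1,3,2,7,5,0]),
    (1,[0,2,1,3,6,7,4,5,9,8]), (6,[2,0,6,7,1,3,8,9,5,4]), (6,[2,0,7,6,1,3,8,9,5,4])],
    [(6,[2,0,6,7,1,3,8,9,4,5])], [(6,[2,0,7,6,1,3,8,9,4,5])], [(2,[0,2,1,3,6,7,4,5,8,9])],
    [(9,[0,3,1,2,7,8,4,5,6,9]), (13,[3,0,7,8,1,2,9,6,4,5]), (16,[3,0,7,8,1,2,9,6,4,5]),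
    (14,[3,7,0,8,9,5,1,2,6,4]), (16,[3,0,8,7,2,1,9,4,6,5]), (11,[1,4,0,5,9,8,3,2,6,7]),
    (11,[0,3,1,2,7,8,4,5,6,9])], [(9,[0,3,1,2,8,7,4,5,6,9]), (13,[3,0,8,7,1,2,9,6,4,5]),
    (16,[3,0,7,8,2,1,9,4,6,5]), (14,[3,8,0,7,9,5,1,2,6,4]), (16,[3,0,8,7,1,2,9,6,4,5]),
    (11,[1,4,0,5,9,7,3,2,6,8]), (11,[0,3,1,2,8,7,4,5,6,9])], [(13,[3,0,7,8,2,1,9,4,6,5]),
    (13,[3,0,8,7,2,1,9,4,6,5]), (6,[0,3,2,1,7,8,6,5,4,9])], [(16,[6,2,8,4,5,0,7,3,9,1]),
    (16,[6,2,7,4,5,0,8,3,9,1]), (18,[0,3,1,2,7,8,4,5,6,9]), (13,[0,3,1,2,7,8,4,5,6,9]),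
    (18,[0,3,1,2,8,7,4,5,6,9]), (13,[0,3,1,2,8,7,4,5,6,9]), (10,[0,3,1,2,7,8,4,5,6,9])],
    [(16,[4,1,8,6,5,0,7,3,9,2]), (14,[4,6,1,8,7,2,0,5,9,3]), (13,[0,3,2,1,8,7,6,5,4,9])],
    [(16,[4,1,7,6,5,0,8,3,9,2]), (14,[4,6,1,7,8,2,0,5,9,3]), (13,[0,3,2,1,7,8,6,5,4,9])],
    [(11,[2,6,0,5,9,8,3,1,4,7]), (11,[2,6,0,5,9,7,3,1,4,8]), (6,[0,3,1,2,7,8,4,5,6,9])],
    [(11,[0,3,2,1,8,7,6,5,4,9])], [(11,[0,3,2,1,7,8,6,5,4,9])], [(10,[0,3,2,1,7,8,6,5,4,9])],
    [(12,[0,1,3,2,4,5,7,6,8,9]), (8,[0,1,3,2,4,5,7,6,8,9]), (12,[0,1,3,2,4,5,7,6,9,8]),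
    (8,[0,1,3,2,4,5,7,6,9,8]), (16,[7,3,8,5,0,6,4,9,1,2]), (16,[7,3,9,5,0,6,4,8,1,2]),
    (10,[1,4,0,5,8,9,3,2,6,7])], [(9,[1,4,0,5,8,7,3,2,9,6]), (13,[4,1,8,7,0,5,6,9,3,2]),
    (7,[0,1,3,2,4,5,7,6,8,9])], [(16,[4,1,8,6,0,5,7,9,3,2])], [], [(8,[0,3,1,2,7,6,4,5,8,9])], [], [],
    [(4,[1,4,0,5,8,9,2,3,7,6]), (6,[6,2,9,7,0,5,4,8,3,1]), (6,[6,2,8,7,0,5,4,9,3,1])],
    [(6,[4,1,8,7,0,5,6,9,3,2])], [(6,[4,1,8,6,0,5,7,9,2,3])], [], [(1,[1,4,0,5,7,8,2,3,9,6])], [],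
    [(12,[0,2,3,1,6,5,7,4,8,9]), (7,[0,2,3,1,6,5,7,4,9,8]), (13,[6,2,8,7,0,5,4,9,3,1]),
    (9,[2,6,0,5,9,7,3,1,8,4]), (16,[7,3,9,5,0,4,6,8,2,1]), (8,[0,3,2,1,7,4,6,5,9,8])],
    [(8,[0,2,3,1,6,5,7,4,9,8])], [(16,[6,2,9,4,0,5,7,8,3,1])], [(10,[2,6,0,5,8,9,3,1,4,7])],
    [(9,[4,7,1,3,9,8,5,0,6,2])], [], [], [(1,[2,6,0,5,8,9,1,3,7,4])], [], [(9,[0,3,1,2,7,8,5,4,6,9]),
    (13,[3,0,7,8,1,2,9,6,5,4]), (9,[0,3,1,2,8,7,5,4,6,9]), (13,[3,0,8,7,1,2,9,6,5,4]),
    (13,[3,0,7,8,2,1,9,5,6,4]), (13,[3,0,8,7,2,1,9,5,6,4]), (16,[6,2,8,5,4,0,7,3,9,1]),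
    (16,[6,2,7,5,4,0,8,3,9,1]), (16,[5,1,8,6,4,0,7,3,9,2]), (14,[5,6,1,8,7,2,0,4,9,3]),
    (16,[5,1,7,6,4,0,8,3,9,2]), (14,[5,6,1,7,8,2,0,4,9,3])], [(16,[3,0,7,8,1,2,9,6,5,4]),
    (16,[3,0,7,8,2,1,9,5,6,4]), (14,[3,8,0,7,9,4,1,2,6,5]), (18,[0,3,1,2,7,8,5,4,6,9]),
    (13,[0,3,1,2,7,8,5,4,6,9]), (13,[0,3,2,1,7,8,6,4,5,9])], [(14,[3,7,0,8,9,4,1,2,6,5]),
    (16,[3,0,8,7,2,1,9,5,6,4]), (16,[3,0,8,7,1,2,9,6,5,4]), (18,[0,3,1,2,8,7,5,4,6,9]),
    (13,[0,3,1,2,8,7,5,4,6,9]), (13,[0,3,2,1,8,7,6,4,5,9])], [(11,[1,5,0,4,9,8,3,2,6,7]),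
    (11,[0,3,1,2,7,8,5,4,6,9]), (11,[1,5,0,4,9,7,3,2,6,8]), (11,[0,3,1,2,8,7,5,4,6,9]),
    (6,[0,3,2,1,7,8,6,4,5,9]), (10,[0,3,1,2,7,8,5,4,6,9])], [(11,[2,6,0,4,9,8,3,1,5,7]),
    (11,[2,6,0,4,9,7,3,1,5,8]), (6,[0,3,1,2,7,8,5,4,6,9]), (11,[0,3,2,1,8,7,6,4,5,9]),
    (11,[0,3,2,1,7,8,6,4,5,9]), (10,[0,3,2,1,7,8,6,4,5,9])], [(12,[0,1,3,2,5,4,7,6,9,8]),
    (8,[0,1,3,2,5,4,7,6,9,8]), (13,[5,1,9,7,0,4,6,8,3,2]), (9,[1,5,0,4,9,7,3,2,8,6]),
    (7,[0,1,3,2,5,4,7,6,8,9]), (16,[5,1,9,6,0,4,7,8,3,2])], [(16,[7,3,8,4,0,6,5,9,1,2]),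
    (16,[7,3,9,4,0,6,5,8,1,2])], [(10,[1,5,0,4,8,9,3,2,6,7])], [(8,[0,3,1,2,7,6,5,4,8,9])],
    [(12,[0,2,3,1,6,4,7,5,9,8]), (13,[6,2,9,7,0,4,5,8,3,1]), (7,[0,2,3,1,6,4,7,5,8,9]),
    (9,[2,6,0,4,9,7,3,1,8,5]), (8,[0,2,3,1,6,4,7,5,9,8]), (16,[6,2,9,5,0,4,7,8,3,1])],
    [(16,[7,3,9,4,0,5,6,8,2,1])], [(8,[0,3,2,1,7,5,6,4,9,8])], [(10,[2,6,0,4,8,9,3,1,5,7])],
    [(9,[4,7,1,2,9,8,5,0,6,3])], [], [], [(4,[1,5,0,4,8,9,2,3,7,6]), (6,[6,2,9,7,0,4,5,8,3,1]),
    (6,[6,2,8,7,0,4,5,9,3,1]), (6,[5,1,8,7,0,4,6,9,3,2]), (6,[5,1,8,6,0,4,7,9,2,3])],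
    [(1,[1,5,0,4,7,8,2,3,9,6])], [(1,[2,6,0,4,8,9,1,3,7,5])], [(4,[0,3,1,2,6,7,4,5,9,8]),
    (6,[8,4,7,9,1,2,3,6,5,0]), (6,[8,4,6,9,1,2,3,7,5,0]), (1,[0,3,1,2,6,7,4,5,9,8]),
    (6,[3,0,6,7,1,2,8,9,5,4]), (6,[3,0,7,6,1,2,8,9,5,4])], [(6,[3,0,6,7,1,2,8,9,4,5])],
    [(6,[3,0,7,6,1,2,8,9,4,5])], [(2,[0,3,1,2,6,7,4,5,8,9])], [(1,[3,6,0,5,8,9,1,2,7,4])], [],
    [(1,[3,6,0,4,8,9,1,2,7,5])], [(0,[0,1,2,3,4,5,6,7,8,9])], [(6,[6,9,2,7,4,5,0,3,8,1]),
    (6,[6,8,2,7,4,5,0,3,9,1]), (16,[7,5,3,8,9,1,2,0,6,4]), (11,[5,7,1,9,6,3,0,4,8,2]),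
    (16,[7,5,3,9,8,1,2,0,6,4]), (11,[5,7,1,8,6,3,0,4,9,2]), (16,[6,5,2,8,9,1,3,0,7,4]),
    (11,[5,6,1,9,7,2,0,4,8,3]), (16,[6,5,2,9,8,1,3,0,7,4]), (11,[5,6,1,8,7,2,0,4,9,3]),
    (19,[5,1,6,7,0,4,9,2,8,3]), (19,[5,1,6,7,0,4,8,2,9,3])], [(16,[7,4,3,9,8,1,2,0,6,5]),
    (11,[4,7,1,8,6,3,0,5,9,2]), (18,[1,0,4,5,2,3,8,7,9,6]), (17,[1,0,4,5,2,3,8,7,9,6]),
    (16,[1,4,0,5,8,7,2,3,6,9]), (9,[1,0,4,5,2,3,7,8,6,9])], [(16,[6,4,2,9,8,1,3,0,7,5]),
    (11,[4,6,1,8,7,2,0,5,9,3]), (16,[1,4,0,5,8,6,3,2,7,9]), (17,[1,0,4,5,3,2,8,6,9,7]),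
    (9,[1,0,4,5,3,2,6,8,7,9]), (18,[1,0,4,5,3,2,8,6,9,7])], [(19,[4,1,6,7,0,5,9,2,8,3]),
    (19,[4,1,6,7,0,5,8,2,9,3])], [(18,[6,2,8,9,0,3,4,7,5,1]), (8,[6,9,2,7,5,8,0,3,1,4]),
    (8,[6,8,2,7,4,9,0,3,1,5]), (5,[0,1,2,3,4,5,6,7,8,9]), (17,[7,3,5,9,2,0,4,1,8,6]),
    (17,[6,2,5,9,3,0,4,1,8,7])], [(17,[7,3,4,9,2,0,5,1,8,6])], [(17,[6,2,4,9,3,0,5,1,8,7])],
    [(10,[1,0,5,4,2,3,9,8,7,6]), (10,[1,0,4,5,2,3,7,8,9,6]), (10,[1,0,5,4,2,3,9,7,8,6]),
    (10,[1,0,4,5,2,3,8,7,9,6]), (1,[1,0,4,5,2,3,7,8,6,9]), (15,[1,5,0,4,9,6,2,3,7,8])],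
    [(15,[1,4,0,5,7,6,2,3,8,9])], [(5,[1,0,4,5,2,3,7,8,6,9])], [], [(11,[5,9,1,3,6,7,4,0,2,8]),
    (11,[5,9,1,3,6,8,4,0,2,7]), (6,[1,4,0,5,7,8,2,3,9,6]), (8,[1,4,0,5,7,8,2,3,6,9]),
    (8,[1,4,0,5,8,7,2,3,6,9]), (10,[1,4,5,0,7,8,6,3,2,9])], [(11,[1,4,5,0,6,7,8,3,2,9])],
    [(5,[2,6,0,3,8,9,1,5,7,4])], [], [(6,[1,5,0,4,8,9,2,3,7,6]), (11,[4,7,1,3,6,8,5,0,2,9]),
    (11,[4,7,1,3,6,9,5,0,2,8]), (8,[1,5,0,4,8,7,2,3,6,9]), (11,[1,5,4,0,6,8,7,3,2,9])],
    [(10,[1,5,4,0,7,8,6,3,2,9])], [(5,[2,6,0,3,8,9,1,4,7,5])], [(11,[5,9,1,2,6,7,4,0,3,8]),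
    (11,[5,9,1,2,6,8,4,0,3,7]), (6,[1,4,0,5,7,8,3,2,9,6]), (8,[1,4,0,5,7,8,3,2,6,9]),
    (8,[1,4,0,5,8,7,3,2,6,9]), (10,[1,4,5,0,7,8,6,2,3,9])], [(11,[1,4,5,0,6,7,8,2,3,9])],
    [(5,[3,6,0,2,8,9,1,5,7,4])], [], [(2,[1,4,0,5,6,7,2,3,8,9])], [(10,[4,6,1,3,8,9,5,0,2,7])],
    [(3,[0,1,2,3,4,5,6,7,8,9])], [(6,[1,5,0,4,8,9,3,2,7,6]), (11,[4,7,1,2,6,8,5,0,3,9]),
    (11,[4,7,1,2,6,9,5,0,3,8]), (8,[1,5,0,4,8,7,3,2,6,9]), (11,[1,5,4,0,6,8,7,2,3,9])],
    [(10,[1,5,4,0,7,8,6,2,3,9])], [(5,[3,6,0,2,8,9,1,4,7,5])], [(10,[4,6,1,2,8,9,5,0,3,7])],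
    [(3,[0,1,2,3,5,4,6,7,8,9])], [(2,[1,5,0,4,6,7,2,3,8,9])], [(16,[7,6,3,8,9,2,1,0,4,5]),
    (16,[7,6,3,9,8,2,1,0,4,5]), (16,[7,5,3,8,9,2,1,0,4,6]), (18,[2,0,5,6,1,3,9,7,8,4]),
    (16,[7,5,3,9,8,2,1,0,4,6]), (18,[2,0,5,6,1,3,8,7,9,4]), (18,[4,1,8,9,0,3,6,7,5,2]),
    (17,[7,3,6,8,1,0,5,2,9,4]), (18,[4,1,8,9,0,3,5,7,6,2]), (17,[7,3,6,9,1,0,5,2,8,4]),
    (17,[7,3,5,8,1,0,6,2,9,4]), (17,[7,3,5,9,1,0,6,2,8,4])], [(6,[4,8,1,7,5,6,0,3,9,2]),
    (11,[6,7,2,9,4,3,0,5,8,1]), (11,[5,7,2,9,4,3,0,6,8,1]), (5,[0,2,1,3,5,6,4,7,9,8]),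
    (8,[4,8,1,7,6,9,0,3,2,5]), (8,[4,8,1,7,5,9,0,3,2,6])], [(16,[4,6,1,8,9,2,3,0,7,5]),
    (19,[6,2,4,7,0,5,8,1,9,3]), (9,[2,0,5,6,1,3,7,9,4,8]), (17,[2,0,5,6,1,3,9,7,8,4]),
    (16,[2,5,0,6,8,7,1,3,4,9]), (17,[4,1,6,8,3,0,5,2,9,7])], [(11,[4,6,7,1,2,9,8,3,0,5]),
    (11,[4,6,7,1,2,8,9,3,0,5])], [(16,[4,5,1,8,9,2,3,0,7,6]), (9,[2,0,5,6,3,1,4,9,7,8]),
    (16,[2,5,0,6,9,4,3,1,7,8]), (17,[2,0,5,6,3,1,8,4,9,7]), (19,[5,2,4,7,0,6,8,1,9,3]),
    (17,[4,1,5,8,3,0,6,2,9,7])], [(11,[4,5,7,1,2,8,9,3,0,6])], [(18,[2,0,5,6,3,1,8,4,9,7])],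
    [(8,[2,5,0,6,8,9,1,3,4,7]), (11,[6,7,2,3,4,9,5,0,1,8]), (8,[2,5,0,6,7,9,1,3,4,8]),
    (11,[6,8,2,3,4,9,5,0,1,7]), (6,[2,5,0,6,7,8,1,3,9,4]), (5,[1,4,0,3,7,8,2,6,9,5])],
    [(10,[2,5,6,0,8,9,4,3,1,7])], [(11,[2,5,6,0,4,8,9,3,1,7])], [], [(8,[2,6,0,5,8,9,1,3,4,7]),
    (8,[2,6,0,5,7,9,1,3,4,8]), (6,[2,6,0,5,7,8,1,3,9,4]), (11,[5,8,2,3,4,9,6,0,1,7]),
    (11,[5,7,2,3,4,9,6,0,1,8]), (5,[1,4,0,3,7,8,2,5,9,6])], [(11,[2,6,5,0,4,9,8,3,1,7])],
    [(10,[2,6,5,0,8,9,4,3,1,7])], [], [(1,[2,0,5,6,1,3,8,9,4,7]), (10,[2,0,6,5,1,3,7,9,8,4]),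
    (10,[2,0,6,5,1,3,7,8,9,4]), (10,[2,0,5,6,1,3,7,8,9,4]), (5,[2,0,5,6,1,3,8,9,4,7])],
    [(15,[2,6,0,5,9,4,1,3,7,8])], [(15,[2,5,0,6,7,4,1,3,8,9])], [(6,[2,5,0,4,8,9,3,1,7,6]),
    (11,[4,7,2,1,6,8,5,0,3,9]), (11,[4,7,2,1,6,9,5,0,3,8]), (8,[2,5,0,4,8,7,3,1,6,9]),
    (11,[2,5,4,0,6,8,7,1,3,9])], [(10,[2,5,4,0,7,8,6,1,3,9])], [(5,[3,6,0,1,8,9,2,4,7,5])],
    [(10,[4,6,2,1,8,9,5,0,3,7])], [(3,[0,2,1,3,5,4,6,7,8,9])], [(2,[2,5,0,4,6,7,1,3,8,9])],
    [(1,[4,1,6,7,0,3,8,9,2,5]), (5,[4,1,6,7,0,3,9,8,2,5]), (5,[4,1,6,7,0,3,8,9,2,5]),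
    (10,[4,1,7,6,0,3,5,9,8,2]), (10,[4,1,6,7,0,3,5,9,8,2])], [(15,[4,5,1,6,7,2,0,3,8,9])],
    [(2,[4,5,1,2,6,7,0,3,8,9])], [(18,[4,1,8,9,0,2,7,5,6,3]), (18,[4,1,8,9,0,2,6,5,7,3]),
    (16,[5,7,2,9,8,3,1,0,4,6]), (17,[5,2,7,9,1,0,6,3,8,4]), (16,[5,7,2,8,9,3,1,0,4,6]),
    (17,[5,2,7,8,1,0,6,3,9,4]), (16,[5,6,2,9,8,3,1,0,4,7]), (17,[5,2,6,9,1,0,7,3,8,4]),
    (16,[5,6,2,8,9,3,1,0,4,7]), (17,[5,2,6,8,1,0,7,3,9,4]), (18,[3,0,6,7,1,2,9,5,8,4]),
    (18,[3,0,6,7,1,2,8,5,9,4])], [(16,[4,7,1,8,9,3,2,0,5,6]), (17,[4,1,7,8,2,0,6,3,9,5]),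
    (19,[7,3,4,5,0,6,8,1,9,2]), (17,[3,0,6,7,1,2,9,5,8,4]), (16,[3,6,0,7,8,5,1,2,4,9]),
    (9,[3,0,6,7,1,2,5,9,4,8])], [(16,[4,6,1,8,9,3,2,0,5,7]), (17,[4,1,6,8,2,0,7,3,9,5]),
    (16,[3,6,0,7,9,4,2,1,5,8]), (17,[3,0,6,7,2,1,8,4,9,5]), (9,[3,0,6,7,2,1,4,9,5,8]),
    (19,[6,3,4,5,0,7,8,1,9,2])], [(18,[3,0,6,7,2,1,9,4,8,5]), (18,[3,0,6,7,2,1,8,4,9,5])],
    [(6,[4,8,1,5,6,7,0,2,9,3]), (8,[4,8,1,5,7,9,0,2,3,6]), (8,[4,8,1,5,6,9,0,2,3,7]),
    (5,[0,3,1,2,6,7,4,5,9,8]), (11,[5,7,4,2,3,9,8,1,0,6]), (11,[5,6,4,2,3,9,8,1,0,7])],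
    [(11,[4,7,5,1,3,9,8,2,0,6])], [(11,[4,6,5,1,3,9,8,2,0,7])], [(8,[3,6,0,5,8,9,1,2,4,7]),
    (8,[3,6,0,5,7,9,1,2,4,8]), (6,[3,6,0,5,7,8,1,2,9,4]), (11,[5,8,3,2,4,9,6,0,1,7]),
    (11,[5,7,3,2,4,9,6,0,1,8]), (5,[1,4,0,2,7,8,3,5,9,6])], [(11,[3,6,5,0,4,9,8,2,1,7])],
    [(10,[3,6,5,0,8,9,4,2,1,7])], [], [(6,[3,6,0,4,8,9,2,1,7,5]), (8,[3,6,0,4,9,7,2,1,5,8]),
    (8,[3,6,0,4,8,7,2,1,5,9]), (11,[4,7,3,1,5,9,6,0,2,8]), (11,[3,6,4,0,5,9,7,1,2,8])],
    [(5,[2,5,0,1,7,8,3,4,9,6])], [(10,[3,6,4,0,8,9,5,1,2,7])], [(10,[4,6,3,1,8,9,5,0,2,7])],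
    [(3,[0,3,1,2,5,4,6,7,8,9])], [(1,[3,0,5,6,1,2,8,9,4,7]), (10,[3,0,6,5,1,2,7,9,8,4]),
    (10,[3,0,6,5,1,2,7,8,9,4]), (10,[3,0,5,6,1,2,7,8,9,4]), (5,[3,0,5,6,1,2,8,9,4,7])],
    [(15,[3,6,0,5,9,4,1,2,7,8])], [(15,[3,5,0,6,7,4,1,2,8,9])], [(2,[3,5,0,4,6,7,1,2,8,9])],
    [(1,[4,1,6,7,0,2,8,9,3,5]), (5,[4,1,6,7,0,2,9,8,3,5]), (5,[4,1,6,7,0,2,8,9,3,5]),
    (10,[4,1,7,6,0,2,5,9,8,3]), (10,[4,1,6,7,0,2,5,9,8,3])], [(15,[4,5,1,6,7,3,0,2,8,9])],
    [(2,[4,5,1,3,6,7,0,2,8,9])], [(1,[4,2,6,7,0,1,8,9,3,5]), (5,[4,2,6,7,0,1,9,8,3,5]),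
    (5,[4,2,6,7,0,1,8,9,3,5]), (10,[4,2,7,6,0,1,5,9,8,3]), (10,[4,2,6,7,0,1,5,9,8,3])],
    [(15,[4,5,2,6,7,3,0,1,8,9])], [(2,[4,5,2,3,6,7,0,1,8,9])], [(0,[4,5,6,7,8,9,0,1,2,3]),
    (3,[4,5,6,7,8,9,0,1,2,3]), (3,[4,5,6,7,9,8,0,1,2,3]), (3,[4,6,5,7,9,8,0,1,2,3]),
    (3,[4,7,5,6,9,8,0,1,2,3])]]"

section \<open>Executable checks of the certificates\<close>

fun sublist_of :: "nat list \<Rightarrow> nat list \<Rightarrow> bool" where
  "sublist_of [] ys = True"
| "sublist_of (x # xs) ys = (List.member ys x \<and> sublist_of xs ys)"

text \<open>Rows are compared as sets, because a relabelling does not respect the order in which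
  neighbours are listed.\<close>

definition same_row :: "nat list \<Rightarrow> nat list \<Rightarrow> bool" where
  "same_row xs ys = (sublist_of xs ys \<and> sublist_of ys xs)"

text \<open>In use, \<open>as\<close> is \<open>q\<close> itself: row \<open>i\<close> of the
  representative, renamed by \<open>q\<close>, is compared with row \<open>q ! i\<close> of the
  explored graph.\<close>

fun iso_rows :: "nat list \<Rightarrow> nat list list \<Rightarrow> nat list \<Rightarrow> nat list list \<Rightarrow> bool" where
  "iso_rows q L [] [] = True"
| "iso_rows q L (a # as) (r # R) = (same_row (L ! a) (map ((!) q) r) \<and> iso_rows q L as R)"
| "iso_rows q L _ _ = False"


fun iso_checks :: "nat list list list \<Rightarrow> (nat list list \<times> nat list list) list \<Rightarrow> (nat \<times> nat list) list \<Rightarrow> bool" where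
  "iso_checks G [] [] = True"
| "iso_checks G ((D, R) # S) ((k, q) # C) = (R = [] \<and> length D = length q \<and> k < 21 \<and>
     distinct q \<and> sublist_of q [0..<length q] \<and> iso_rows q (rev D) q (G ! k) \<and> iso_checks G S C)"
| "iso_checks G _ _ = False"

text \<open>The second half of the search is run separately for each state of the first half, since the simplifier is
  slow on long lists.\<close>

fun group_checks :: "nat list list list \<Rightarrow> (nat list list \<times> nat list list) list \<Rightarrow> (nat \<times> nat list) list list \<Rightarrow> bool" where
  "group_checks G [] [] = True"
| "group_checks G (s # S) (c # C) = (iso_checks G (descend 5 5 [s]) c \<and> group_checks G S C)"
| "group_checks G _ _ = False"

text \<open>The whole search and all relabellings are evaluated by rewriting with the code
  equations, so this computation is itself a proof by the simplifier.\<close>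

lemma leaves_isomorphic: "group_checks graphs (descend 0 5 [([], [])]) leaf_isos"
  by code_simp

definition cubic_rows :: "nat list list \<Rightarrow> bool" where
  "cubic_rows L \<longleftrightarrow> length L = 10 \<and> list_all (\<lambda>i. distinct (L ! i) \<and> length (L ! i) = 3 \<and>
     list_all (\<lambda>j. j < 10 \<and> j \<noteq> i \<and> List.member (L ! j) i) (L ! i)) [0..<10]"

lemma graphs_cubic: "list_all cubic_rows graphs"
  by code_simp

lemma spectrum_certs_hold: "spectrum_certs graphs spectra"
  by code_simp

text \<open>Positions in \<open>graphs\<close>, smaller one first. Number 3 is the disjoint union of
  the triangular prism and the complete graph on four vertices; number 20 is the Petersen
  graph.\<close>

definition coincident :: "nat \<Rightarrow> nat \<Rightarrow> bool" where
  "coincident i j \<longleftrightarrow> i = 3 \<and> j = 4 \<or> i = 14 \<and> j = 15 \<or> i = 19 \<and> j = 20"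

definition separated :: "int list \<Rightarrow> int list \<Rightarrow> bool" where
  "separated lo up \<longleftrightarrow> list_all (\<lambda>i. list_all (\<lambda>j. i < j \<longrightarrow> coincident i j \<or> up ! i < lo ! j)
     [0..<length lo]) [0..<length lo]"

lemma spectra_separated:
  "separated (map (\<lambda>S. \<Sum>(f, I)\<leftarrow>S. lower_sum I) spectra) (map (\<lambda>S. \<Sum>(f, I)\<leftarrow>S. upper_sum I) spectra)"
  by code_simp

lemma length_graphs: "length graphs = 21" and length_spectra: "length spectra = 21"
  by (simp_all add: graphs_def spectra_def)

lemma upper_less_lower:
  assumes "i < j" "j < 21" "\<not> coincident i j"
  shows "(\<Sum>(f, I)\<leftarrow>spectra ! i. upper_sum I) < (\<Sum>(f, I)\<leftarrow>spectra ! j. lower_sum I)"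
proof -
  have "\<forall>i\<in>{0..<21}. \<forall>j\<in>{0..<21}. i < j \<longrightarrow> coincident i j \<or>
      (\<Sum>(f, I)\<leftarrow>spectra ! i. upper_sum I) < (\<Sum>(f, I)\<leftarrow>spectra ! j. lower_sum I)"
    using spectra_separated by (simp add: separated_def list_all_iff length_spectra)
  moreover have "i \<in> {0..<21}" "j \<in> {0..<21}" using assms by auto
  ultimately show ?thesis using assms by blast
qed

lemma sublist_of_iff: "sublist_of xs ys \<longleftrightarrow> set xs \<subseteq> set ys"
  by (induction xs) (auto simp: List.member_iff)

lemma same_row_iff: "same_row xs ys \<longleftrightarrow> set xs = set ys"
  by (auto simp: same_row_def sublist_of_iff)

lemma iso_rows_sound:
  "iso_rows q L as R \<Longrightarrow> length as = length R \<and> (\<forall>i<length R. set (L ! (as ! i)) = (!) q ` set (R ! i))"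
  by (induction q L as R rule: iso_rows.induct) (auto simp: same_row_iff All_less_Suc2)

lemma iso_checks_sound:
  assumes "iso_checks G S C" "(D, R) \<in> set S"
  shows "\<exists>k q. k < 21 \<and> length D = length q \<and> distinct q \<and> set q \<subseteq> {..<length q} \<and>
    iso_rows q (rev D) q (G ! k)"
  using assms
  by (induction G S C rule: iso_checks.induct) (auto simp: sublist_of_iff lessThan_atLeast0)

lemma group_checks_sound:
  "group_checks G S C \<Longrightarrow> s \<in> set S \<Longrightarrow> \<exists>c. iso_checks G (descend 5 5 [s]) c"
  by (induction G S C rule: group_checks.induct) auto

lemma cubic_rows_iff:
  "cubic_rows L \<longleftrightarrow> length L = 10 \<and> (\<forall>i<10. distinct (L ! i) \<and> length (L ! i) = 3 \<and>
     (\<forall>j\<in>set (L ! i). j < 10 \<and> j \<noteq> i \<and> i \<in> set (L ! j)))"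
  by (simp only: cubic_rows_def list_all_iff List.member_iff set_upt Ball_def atLeastLessThan_iff le0 simp_thms)

lemma cubic_rowsD:
  assumes "cubic_rows L"
  shows "length L = 10" "i < 10 \<Longrightarrow> distinct (L ! i)" "i < 10 \<Longrightarrow> length (L ! i) = 3"
    "i < 10 \<Longrightarrow> j \<in> set (L ! i) \<Longrightarrow> j < 10 \<and> j \<noteq> i \<and> i \<in> set (L ! j)"
  using assms unfolding cubic_rows_iff by blast+

lemma graph_cubic: "k < 21 \<Longrightarrow> cubic_rows (graphs ! k)"
  using graphs_cubic by (simp add: list_all_length length_graphs)

lemma cubic_rows_wf:
  assumes "cubic_rows L"
  shows "wf_rows L"
  unfolding wf_rows_def
proof
  fix r assume "r \<in> set L"
  then obtain i where i: "i < 10" "r = L ! i"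
    using cubic_rowsD(1)[OF assms] by (metis in_set_conv_nth)
  then show "distinct r \<and> set r \<subseteq> {..<length L}"
    using cubic_rowsD(1,2)[OF assms] cubic_rowsD(4)[OF assms i(1)] by (simp add: subset_iff)
qed

text \<open>The search yields a numbering \<open>xs\<close> of the vertices, and the certificate a
  relabelling \<open>q\<close> of that numbering. Their composition lists the vertices in the order
  of the representative.\<close>

lemma cubic_graph_realises:
  assumes G: "G \<in> cubic_graphs 10"
  shows "\<exists>k xs. k < 21 \<and> realises G xs (graphs ! k)"
proof -
  have pg: "pair_graph G" and card: "card (pverts G) = 10"
    and deg: "\<And>v. v \<in> pverts G \<Longrightarrow> degree_of G v = 3"
    using G by (auto simp: cubic_graphs_def)
  let ?N = "\<lambda>v. {w. (v, w) \<in> parcs G}"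
  interpret G: pair_graph G by (rule pg)
  interpret cubic10 "pverts G" ?N
  proof
    show "x \<notin> ?N x" for x using G.pair_no_loops by fastforce
    show "x \<in> ?N y" if "y \<in> ?N x" for x y
      using that G.pair_sym_arcs by (auto simp: symmetric_def dest: symD)
    show "card (?N x) = 3" if "x \<in> pverts G" for x using deg[OF that] by (simp add: card_out_neighbours)
    show "?N x \<subseteq> pverts G" for x using pair_graph_arc_verts[OF pg] by auto
  qed (rule card)
  obtain s D xs where s: "s \<in> set (descend 0 5 [([], [])])" and D: "(D, []) \<in> set (descend 5 5 [s])" "length D = 10" and xs: "distinct xs" "set xs = pverts G"
    and nb: "\<And>i. i < 10 \<Longrightarrow> set (rev D ! i) = {j. j < 10 \<and> (xs ! i, xs ! j) \<in> parcs G}"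
    using leaf_complete by auto
  from group_checks_sound[OF leaves_isomorphic s] obtain c where "iso_checks graphs (descend 5 5 [s]) c" ..
  from iso_checks_sound[OF this D(1)] obtain k q where k: "k < 21" and
    q: "length q = 10" "distinct q" "set q \<subseteq> {..<10}" "iso_rows q (rev D) q (graphs ! k)"
    using D(2) by auto
  have len: "length xs = 10" using distinct_card[OF xs(1)] xs(2) card by simp
  have qn: "q ! i < 10" if "i < 10" for i using subsetD[OF q(3) nth_mem[of i q]] q(1) that by simp
  \<comment> \<open>Ten distinct numbers below ten: \<open>q\<close> is a permutation.\<close>
  have "set q = {..<10}" using q by (intro card_subset_eq) (auto simp: distinct_card)
  moreover have "set xs = (!) xs ` {..<10}" using len by (auto simp: set_conv_nth)
  ultimately have sets: "set (map ((!) xs) q) = pverts G" using xs(2) by simp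
  have "inj_on ((!) xs) (set q)" using q(3) xs(1) len by (auto simp: inj_on_def nth_eq_iff_index_eq subset_iff)
  then have dist: "distinct (map ((!) xs) q)" using q(2) by (simp add: distinct_map)
  have gk: "length (graphs ! k) = 10" "\<And>i. i < 10 \<Longrightarrow> set (graphs ! k ! i) \<subseteq> {..<10}"
    using cubic_rowsD(1,4)[OF graph_cubic[OF k]] by auto
  have "(xs ! (q ! i), xs ! (q ! j)) \<in> parcs G \<longleftrightarrow> j \<in> set (graphs ! k ! i)" if "i < 10" "j < 10" for i j
  proof -
    have "(xs ! (q ! i), xs ! (q ! j)) \<in> parcs G \<longleftrightarrow> q ! j \<in> set (rev D ! (q ! i))"
      using nb[OF qn[OF that(1)]] qn[OF that(2)] by simp
    also have "set (rev D ! (q ! i)) = (!) q ` set (graphs ! k ! i)"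
      using iso_rows_sound[OF q(4)] q(1) that(1) by simp
    also have "q ! j \<in> \<dots> \<longleftrightarrow> j \<in> set (graphs ! k ! i)"
      using q(1,2) that gk(2)[OF that(1)] by (auto simp: nth_eq_iff_index_eq subset_iff image_iff)
    finally show ?thesis .
  qed
  then have "realises G (map ((!) xs) q) (graphs ! k)"
    using dist sets gk(1) q(1) by (simp add: realises_def)
  with k show ?thesis by blast
qed

text \<open>A concrete graph for each representative, which shows that all 21 classes occur over the
  natural numbers.\<close>

definition rows_graph :: "nat list list \<Rightarrow> nat pair_pre_digraph" where
  "rows_graph L = \<lparr>pverts = {..<length L}, parcs = {(i, j). i < length L \<and> j \<in> set (L ! i)}\<rparr>"

lemma rows_graph_realises: "realises (rows_graph L) [0..<length L] L"
  by (auto simp: realises_def rows_graph_def)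

lemma rows_graph_cubic:
  assumes "cubic_rows L"
  shows "rows_graph L \<in> cubic_graphs 10"
proof -
  have L: "length L = 10" "\<And>i. i < 10 \<Longrightarrow> distinct (L ! i) \<and> length (L ! i) = 3"
    "\<And>i j. i < 10 \<Longrightarrow> j \<in> set (L ! i) \<Longrightarrow> j < 10 \<and> j \<noteq> i \<and> i \<in> set (L ! j)"
    using cubic_rowsD[OF assms] by blast+
  let ?G = "rows_graph L"
  have V: "pverts ?G = {..<10}" and E: "parcs ?G = {(i, j). i < 10 \<and> j \<in> set (L ! i)}"
    by (auto simp: rows_graph_def L)
  have arcs: "fst e < 10 \<and> snd e < 10 \<and> fst e \<noteq> snd e \<and> prod.swap e \<in> parcs ?G" if e: "e \<in> parcs ?G" for e
  proof -
    obtain i j where ij: "e = (i, j)" by (cases e)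
    with e have "i < 10" "j \<in> set (L ! i)" by (auto simp: E)
    with L(3)[OF this] ij show ?thesis by (simp add: E)
  qed
  then have "parcs ?G \<subseteq> {..<10} \<times> {..<10}" by (auto dest: arcs)
  then have fin: "finite (parcs ?G)" by (rule finite_subset) simp
  have sym: "symmetric (with_proj ?G)" using arcs by (fastforce simp: symmetric_def intro!: symI)
  have "pair_graph ?G"
  proof
    show "fst e \<in> pverts ?G" "snd e \<in> pverts ?G" "fst e \<noteq> snd e" if "e \<in> parcs ?G" for e
      using arcs[OF that] by (simp_all add: V)
    show "finite (pverts ?G)" by (simp add: V)
  qed (rule fin sym)+
  moreover have "degree_of ?G v = 3" if "v < 10" for v
    using L(2)[OF that] that distinct_card[of "L ! v"] by (simp add: card_out_neighbours E)
  ultimately show ?thesis by (simp add: cubic_graphs_def V)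
qed

lemma spectrum_certs_nth:
  "spectrum_certs G T \<Longrightarrow> k < length G \<Longrightarrow> spectrum_cert (G ! k) (T ! k)"
  by (induction G T arbitrary: k rule: spectrum_certs.induct) (auto simp: nth_Cons split: nat.splits)

lemma char_poly_graph:
  assumes k: "k < 21"
  shows "factors_ok (spectra ! k)"
    and "(\<Sum>(f, I)\<leftarrow>spectra ! k. length I) = 10"
    and "char_poly (rows_matrix (graphs ! k)) = Poly (map real_of_int (factors_prod (spectra ! k)))"
proof -
  let ?L = "graphs ! k" and ?p = "factors_prod (spectra ! k)"
  have "spectrum_cert ?L (spectra ! k)"
    using spectrum_certs_nth[OF spectrum_certs_hold] k by (simp add: length_graphs)
  then obtain cs where cs: "rev ?p = 1 # cs" "length cs = length ?L" "leverrier ?L 1 (id_rows (length ?L)) cs"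
    and ok: "factors_ok (spectra ! k)" "(\<Sum>(f, I)\<leftarrow>spectra ! k. length I) = length ?L"
    by (auto split: list.splits)
  show "factors_ok (spectra ! k)" "(\<Sum>(f, I)\<leftarrow>spectra ! k. length I) = 10"
    using ok cubic_rowsD(1)[OF graph_cubic[OF k]] by simp_all
  have "?p = rev (1 # cs)" using cs(1) by (metis rev_rev_ident)
  then show "char_poly (rows_matrix ?L) = Poly (map real_of_int ?p)"
    using char_poly_leverrier[OF cubic_rows_wf[OF graph_cubic[OF k]] cs(3,2)] by simp
qed

section \<open>Energies of the representatives and the three coincidences\<close>

definition energy_of :: "nat \<Rightarrow> real" where
  "energy_of k = (\<Sum>x\<in>#spectrum_of (spectra ! k). \<bar>x\<bar>)"

lemma adjacency_spectrum_realises: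
  assumes "k < 21" "realises G xs (graphs ! k)"
  shows "adjacency_spectrum G = spectrum_of (spectra ! k)"
  unfolding adjacency_spectrum_def eigenvalues_def realises_char_poly[OF assms(2)] char_poly_graph(3)[OF assms(1)]
  using factors_ok_sound[OF char_poly_graph(1)[OF assms(1)]] by simp

lemma energy_realises:
  assumes "k < 21" "realises G xs (graphs ! k)"
  shows "energy G = energy_of k"
  by (simp add: energy_def energy_of_def adjacency_spectrum_realises[OF assms])

lemma randic_energy_realises:
  assumes G: "G \<in> cubic_graphs 10" and k: "k < 21" and r: "realises G xs (graphs ! k)"
  shows "randic_energy G = energy_of k / 3"
proof -
  let ?A = "adjacency_matrix G" and ?S = "spectrum_of (spectra ! k)"
  have A: "?A \<in> carrier_mat 10 10" using G by (auto simp: adjacency_matrix_def cubic_graphs_def Let_def)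
  have pr: "proots (char_poly ?A) = ?S"
    using adjacency_spectrum_realises[OF k r] by (simp add: adjacency_spectrum_def eigenvalues_def)
  \<comment> \<open>The ten isolating intervals account for all eigenvalues, as the scaling lemma
    requires.\<close>
  have "size ?S = 10"
    using factors_ok_sound[OF char_poly_graph(1)[OF k]] char_poly_graph(2)[OF k] by simp
  then have "eigenvalues (randic_matrix G) = image_mset ((*) (1 / 3)) ?S"
    unfolding eigenvalues_def randic_matrix_cubic[OF G]
    using proots_char_poly_smult[OF A, of "1 / 3"] by (simp add: pr)
  then have "randic_energy G = (\<Sum>x\<in>#?S. \<bar>x\<bar> / 3)"
    by (simp add: randic_energy_def image_mset.compositionality o_def abs_mult)
  also have "(\<Sum>x\<in>#M. \<bar>x\<bar> / 3) = (\<Sum>x\<in>#M. \<bar>x\<bar>) / 3" for M :: "real multiset"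
    by (induction M) (simp_all add: add_divide_distrib)
  finally show ?thesis by (simp add: energy_of_def)
qed

text \<open>The condition on sums makes \<open>D\<close> disjoint from its negative, and for
  \<open>x = y\<close> it excludes 0. So the intersection is exactly \<open>C\<close>, and negating
  \<open>D\<close> leaves absolute values unchanged.\<close>

lemma reflected_part:
  fixes C D :: "real multiset"
  assumes S: "S = C + D" and T: "T = C + image_mset uminus D"
    and D: "\<forall>x\<in>#D. \<forall>y\<in>#D. x + y \<noteq> 0"
  shows "(\<Sum>x\<in>#S. \<bar>x\<bar>) = (\<Sum>x\<in>#T. \<bar>x\<bar>)" "S - S \<inter># T = D" "T - S \<inter># T = image_mset uminus D"
proof -
  have "- x \<notin># D" if "x \<in># D" for x using D that by force
  then have "D \<inter># image_mset uminus D = {#}" by (auto simp: disjunct_not_in)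
  then have "S \<inter># T = C" unfolding S T by (simp add: multiset_eq_iff) (metis min_add_distrib_right add.right_neutral)
  then show "S - S \<inter># T = D" "T - S \<inter># T = image_mset uminus D" by (simp_all add: S T)
  show "(\<Sum>x\<in>#S. \<bar>x\<bar>) = (\<Sum>x\<in>#T. \<bar>x\<bar>)"
    by (simp add: S T image_mset.compositionality o_def)
qed

text \<open>The only irrational eigenvalues in the coincidences, from numbers 14 and 15. The
  substitution of \<open>- x\<close> for \<open>x\<close> exchanges the two quadratics.\<close>

lemma proots_quadratic:
  "proots [:- 4, 1, 1:] = {#(- 1 + sqrt 17) / 2, (- 1 - sqrt 17) / 2#}"
  "proots [:- 4, - 1, 1:] = {#(1 + sqrt 17) / 2, (1 - sqrt 17) / 2#}"
proof -
  have "[:- 4, 1, 1:] = [:- ((- 1 + sqrt 17) / 2), 1:] * [:- ((- 1 - sqrt 17) / 2), 1:]"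
    by (simp add: field_simps)
  then show "proots [:- 4, 1, 1:] = {#(- 1 + sqrt 17) / 2, (- 1 - sqrt 17) / 2#}"
    by (simp add: proots_mult del: mult_pCons_left mult_pCons_right)
  have "[:- 4, - 1, 1:] = [:- ((1 + sqrt 17) / 2), 1:] * [:- ((1 - sqrt 17) / 2), 1:]"
    by (simp add: field_simps)
  then show "proots [:- 4, - 1, 1:] = {#(1 + sqrt 17) / 2, (1 - sqrt 17) / 2#}"
    by (simp add: proots_mult del: mult_pCons_left mult_pCons_right)
qed

text \<open>The witnesses are read off \<open>spectra\<close>: \<open>C\<close> is the common part
  of the two lists and \<open>D\<close> the rest of the first.\<close>

lemma coincident_spectra:
  assumes "coincident i j"
  shows "\<exists>C D. spectrum_of (spectra ! i) = C + D \<and> spectrum_of (spectra ! j) = C + image_mset uminus D \<and>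
    size D = 3 \<and> (\<forall>x\<in>#D. \<forall>y\<in>#D. x + y \<noteq> 0)"
  using assms unfolding coincident_def
proof (elim disjE conjE)
  assume "i = 3" "j = 4"
  then show ?thesis
    by (intro exI[of _ "{#- 2, - 1, - 1, 0, 0, 1, 3#}"] exI[of _ "{#- 2, - 1, 3#}"])
      (simp add: spectrum_of_def spectra_def add_mset_commute)
next
  assume ij: "i = 14" "j = 15"
  \<comment> \<open>Replacing \<open>sqrt 17\<close> by a variable \<open>s\<close> leaves linear
    arithmetic: the sums that could vanish are multiples of \<open>1 - s\<close>,
    \<open>1 + s\<close> or constants, all nonzero for \<open>s > 1\<close>.\<close>
  have "\<forall>x\<in>#{#1, (- 1 + s) / 2, (- 1 - s) / 2#}. \<forall>y\<in>#{#1, (- 1 + s) / 2, (- 1 - s) / 2#}. x + y \<noteq> 0"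
    if "1 < s" for s :: real
    using that by (auto simp: field_simps)
  from this[of "sqrt 17"]
  have "\<forall>x\<in>#{#1, (- 1 + sqrt 17) / 2, (- 1 - sqrt 17) / 2#}.
      \<forall>y\<in>#{#1, (- 1 + sqrt 17) / 2, (- 1 - sqrt 17) / 2#}. x + y \<noteq> 0"
    by simp
  then show ?thesis
    unfolding ij
    by (intro exI[of _ "{#- 2, - 2, - 1, 0, 1, 1, 3#}"] exI[of _ "{#1, (- 1 + sqrt 17) / 2, (- 1 - sqrt 17) / 2#}"])
      (simp add: spectrum_of_def spectra_def proots_quadratic add_mset_commute minus_divide_left del: set_mset_add_mset_insert)
next
  assume "i = 19" "j = 20"
  then show ?thesis
    by (intro exI[of _ "{#- 2, - 2, - 2, 1, 1, 1, 3#}"] exI[of _ "{#- 1, - 1, 2#}"])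
      (simp add: spectrum_of_def spectra_def add_mset_commute)
qed

lemma coincident_energy: "coincident i j \<Longrightarrow> energy_of i = energy_of j"
  using coincident_spectra[of i j] reflected_part(1) unfolding energy_of_def by metis

lemma energy_of_less:
  assumes "i < j" "j < 21" "\<not> coincident i j"
  shows "energy_of i < energy_of j"
proof -
  have "1000 * energy_of i \<le> (\<Sum>(f, I)\<leftarrow>spectra ! i. upper_sum I)"
    using factors_ok_sound[OF char_poly_graph(1)[of i]] assms by (simp add: energy_of_def)
  also have "real_of_int (\<Sum>(f, I)\<leftarrow>spectra ! i. upper_sum I) < real_of_int (\<Sum>(f, I)\<leftarrow>spectra ! j. lower_sum I)"
    using upper_less_lower[OF assms] by (simp only: of_int_less_iff)
  also have "\<dots> \<le> 1000 * energy_of j"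
    using factors_ok_sound[OF char_poly_graph(1)[of j]] assms by (simp add: energy_of_def)
  finally show ?thesis by simp
qed

lemma energy_of_eq_iff:
  assumes "i < 21" "j < 21"
  shows "energy_of i = energy_of j \<longleftrightarrow> i = j \<or> coincident i j \<or> coincident j i"
proof
  assume e: "energy_of i = energy_of j"
  show "i = j \<or> coincident i j \<or> coincident j i"
  proof (rule ccontr)
    assume n: "\<not> (i = j \<or> coincident i j \<or> coincident j i)"
    then consider "i < j" | "j < i" by linarith
    then show False
    proof cases
      case 1
      with n have "energy_of i < energy_of j" by (intro energy_of_less assms) auto
      with e show False by simp
    next
      case 2
      with n have "energy_of j < energy_of i" by (intro energy_of_less assms) auto
      with e show False by simp
    qed
  qed
qed (auto dest: coincident_energy)

lemma coincident_differ:
  assumes "coincident i j"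
  defines "S \<equiv> spectrum_of (spectra ! i)" and "T \<equiv> spectrum_of (spectra ! j)"
  shows "size (S - S \<inter># T) = 3" "size (T - S \<inter># T) = 3"
proof -
  obtain C D where *: "S = C + D" "T = C + image_mset uminus D" "\<forall>x\<in>#D. \<forall>y\<in>#D. x + y \<noteq> 0" "size D = 3"
    using coincident_spectra[OF assms(1)] by (auto simp: S_def T_def)
  note r = reflected_part(2,3)[OF *(1-3)]
  show "size (S - S \<inter># T) = 3" "size (T - S \<inter># T) = 3" unfolding r using *(4) by simp_all
qed

text \<open>Equal spectra give equal energies, so distinct indices would have to be coincident; but
  coincident spectra differ in three values.\<close>

lemma spectrum_of_inj:
  assumes "i < 21" "j < 21" "spectrum_of (spectra ! i) = spectrum_of (spectra ! j)"
  shows "i = j"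
proof -
  have "energy_of i = energy_of j" using assms(3) by (simp add: energy_of_def)
  moreover have "\<not> coincident i j" "\<not> coincident j i"
    using coincident_differ(1)[of i j] coincident_differ(1)[of j i] assms(3) by auto
  ultimately show ?thesis using energy_of_eq_iff[OF assms(1,2)] by blast
qed

section \<open>Isomorphism classes and their number\<close>

definition graph_class :: "'a pair_pre_digraph \<Rightarrow> nat" where
  "graph_class G = (SOME k. k < 21 \<and> (\<exists>xs. realises G xs (graphs ! k)))"

lemma graph_class:
  assumes "G \<in> cubic_graphs 10"
  shows "graph_class G < 21" "\<exists>xs. realises G xs (graphs ! graph_class G)"
proof -
  have "\<exists>k. k < 21 \<and> (\<exists>xs. realises G xs (graphs ! k))" using cubic_graph_realises[OF assms] by blast
  from someI_ex[OF this] show "graph_class G < 21" "\<exists>xs. realises G xs (graphs ! graph_class G)"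
    unfolding graph_class_def by blast+
qed

text \<open>The spectrum determines the index, so a graph cannot realise two representatives and the
  choice in \<open>graph_class\<close> is unambiguous.\<close>

lemma graph_class_eqI:
  assumes "G \<in> cubic_graphs 10" "k < 21" "realises G xs (graphs ! k)"
  shows "graph_class G = k"
proof -
  obtain ys where "realises G ys (graphs ! graph_class G)" using graph_class(2)[OF assms(1)] by blast
  then show ?thesis
    using adjacency_spectrum_realises[OF assms(2,3)] adjacency_spectrum_realises graph_class(1)[OF assms(1)]
      assms(2) by (metis spectrum_of_inj)
qed

text \<open>Turns isomorphism, even between graphs over different vertex types, into equality of
  indices.\<close>

lemma isomorphic_iff_class:
  assumes G: "G \<in> cubic_graphs 10" and H: "H \<in> cubic_graphs 10"
  shows "isomorphic G H \<longleftrightarrow> graph_class G = graph_class H"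
proof
  have pg: "pair_graph G" "pair_graph H" using G H by (auto simp: cubic_graphs_def)
  obtain xs where xs: "realises G xs (graphs ! graph_class G)" using graph_class(2)[OF G] by blast
  obtain ys where ys: "realises H ys (graphs ! graph_class H)" using graph_class(2)[OF H] by blast
  show "graph_class G = graph_class H" if "isomorphic G H"
    using isomorphic_realises[OF that pg(1) xs] graph_class_eqI[OF H graph_class(1)[OF G]] by auto
  show "isomorphic G H" if "graph_class G = graph_class H"
    using realises_isomorphic[OF pg(1) xs pg(2)] ys that by simp
qed

lemma class_invariants:
  assumes "G \<in> cubic_graphs 10"
  shows "adjacency_spectrum G = spectrum_of (spectra ! graph_class G)"
    and "energy G = energy_of (graph_class G)"
    and "randic_energy G = energy_of (graph_class G) / 3"
proof -
  obtain xs where xs: "realises G xs (graphs ! graph_class G)" using graph_class(2)[OF assms] by blast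
  note k = graph_class(1)[OF assms]
  show "adjacency_spectrum G = spectrum_of (spectra ! graph_class G)" by (rule adjacency_spectrum_realises[OF k xs])
  show "energy G = energy_of (graph_class G)" by (rule energy_realises[OF k xs])
  show "randic_energy G = energy_of (graph_class G) / 3" by (rule randic_energy_realises[OF assms k xs])
qed

lemma ex_graph_class: "k < 21 \<Longrightarrow> \<exists>G \<in> cubic_graphs 10. graph_class (G :: nat pair_pre_digraph) = k"
  using rows_graph_cubic[OF graph_cubic[of k]] graph_class_eqI rows_graph_realises by blast

lemma card_quotient_iso_rel:
  assumes "F' \<subseteq> F" and cls: "\<And>G H. G \<in> F \<Longrightarrow> H \<in> F \<Longrightarrow> isomorphic G H \<longleftrightarrow> c G = c H"
  shows "card (F' // iso_rel F) = card (c ` F')"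
proof -
  have "iso_rel F `` {G} = {H \<in> F. c H = c G}" if "G \<in> F'" for G
    using that assms by (auto simp: iso_rel_def)
  then have "F' // iso_rel F = (\<lambda>k. {H \<in> F. c H = k}) ` c ` F'"
    by (auto simp: quotient_def)
  moreover have "inj_on (\<lambda>k. {H \<in> F. c H = k}) (c ` F')"
    using assms(1) by (auto simp: inj_on_def set_eq_iff)
  ultimately show ?thesis by (simp add: card_image)
qed

theorem theorem2p4:
  fixes F :: "nat pair_pre_digraph set"
  assumes "F = cubic_graphs 10"
  shows "card (F // iso_rel F) = 21
    \<and> card ({G \<in> F. \<not> unique_in energy F G} // iso_rel F) = 6
    \<and> card ({G \<in> F. \<not> unique_in randic_energy F G} // iso_rel F) = 6
    \<and> (\<forall>G\<in>F. unique_in energy F G \<longleftrightarrow> unique_in randic_energy F G)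
    \<and> (\<forall>(G :: 'a pair_pre_digraph) \<in> cubic_graphs 10. \<forall>(H :: 'b pair_pre_digraph) \<in> cubic_graphs 10.
         (energy G = energy H \<longleftrightarrow> randic_energy G = randic_energy H)
       \<and> (\<not> isomorphic G H \<and> energy G = energy H \<longrightarrow>
            (let S = adjacency_spectrum G; T = adjacency_spectrum H
             in size (S - S \<inter># T) = 3 \<and> size (T - S \<inter># T) = 3)))"
proof -
  let ?P = "{3, 4, 14, 15, 19, 20 :: nat}"
  have classes: "graph_class ` F = {..<21}"
    using graph_class(1) ex_graph_class unfolding assms by (auto simp: image_iff)
  have iso: "isomorphic G H \<longleftrightarrow> graph_class G = graph_class H" if "G \<in> F" "H \<in> F" for G H
    using that isomorphic_iff_class unfolding assms by blast
  \<comment> \<open>Failure of uniqueness becomes a question about indices. The six exceptional ones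
    are those occurring in \<open>coincident\<close>.\<close>
  have partner: "(\<exists>j<21. k \<noteq> j \<and> energy_of j = energy_of k) \<longleftrightarrow> k \<in> ?P" if "k < 21" for k
  proof
    assume "\<exists>j<21. k \<noteq> j \<and> energy_of j = energy_of k"
    then show "k \<in> ?P" using energy_of_eq_iff that by (auto simp: coincident_def)
  next
    assume "k \<in> ?P"
    then have "\<exists>j<21. k \<noteq> j \<and> (coincident j k \<or> coincident k j)" by (auto simp: coincident_def)
    then show "\<exists>j<21. k \<noteq> j \<and> energy_of j = energy_of k" using energy_of_eq_iff[OF _ that] by blast
  qed
  have unique: "unique_in energy F G \<longleftrightarrow> graph_class G \<notin> ?P"
    "unique_in randic_energy F G \<longleftrightarrow> graph_class G \<notin> ?P" if G: "G \<in> F" for G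
  proof -
    have k: "graph_class G < 21" using G classes by blast
    have ex: "(\<exists>H\<in>F. \<not> isomorphic G H \<and> energy_of (graph_class H) = energy_of (graph_class G)) \<longleftrightarrow>
      (\<exists>j\<in>graph_class ` F. graph_class G \<noteq> j \<and> energy_of j = energy_of (graph_class G))"
      using iso[OF G] by auto
    have inv: "energy H = energy_of (graph_class H)" "randic_energy H = energy_of (graph_class H) / 3"
      if "H \<in> F" for H using class_invariants[of H] that assms by auto
    have "unique_in energy F G \<longleftrightarrow>
        \<not> (\<exists>H\<in>F. \<not> isomorphic G H \<and> energy_of (graph_class H) = energy_of (graph_class G))"
      "unique_in randic_energy F G \<longleftrightarrow>
        \<not> (\<exists>H\<in>F. \<not> isomorphic G H \<and> energy_of (graph_class H) = energy_of (graph_class G))"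
      unfolding unique_in_def by (simp_all add: inv G cong: bex_cong)
    moreover have "(\<exists>j\<in>graph_class ` F. graph_class G \<noteq> j \<and> energy_of j = energy_of (graph_class G)) \<longleftrightarrow>
        graph_class G \<in> ?P"
      using partner[OF k] unfolding classes by blast
    ultimately show "unique_in energy F G \<longleftrightarrow> graph_class G \<notin> ?P"
      "unique_in randic_energy F G \<longleftrightarrow> graph_class G \<notin> ?P"
      using ex by blast+
  qed
  have sub: "{G \<in> F. graph_class G \<in> ?P} \<subseteq> F" by blast
  have "graph_class ` {G \<in> F. graph_class G \<in> ?P} = graph_class ` F \<inter> ?P" by blast
  also have "\<dots> = ?P" unfolding classes by auto
  finally have P: "card ({G \<in> F. graph_class G \<in> ?P} // iso_rel F) = 6"
    using card_quotient_iso_rel[OF sub iso] by simp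
  have "card (F // iso_rel F) = 21"
    using card_quotient_iso_rel[OF subset_refl iso] by (simp add: classes)
  moreover have "{G \<in> F. \<not> unique_in energy F G} = {G \<in> F. graph_class G \<in> ?P}"
    "{G \<in> F. \<not> unique_in randic_energy F G} = {G \<in> F. graph_class G \<in> ?P}"
    using unique by auto
  moreover have "(energy G = energy H \<longleftrightarrow> randic_energy G = randic_energy H)
       \<and> (\<not> isomorphic G H \<and> energy G = energy H \<longrightarrow>
            (let S = adjacency_spectrum G; T = adjacency_spectrum H
             in size (S - S \<inter># T) = 3 \<and> size (T - S \<inter># T) = 3))"
    if G: "G \<in> cubic_graphs 10" and H: "H \<in> cubic_graphs 10"
    for G :: "'a pair_pre_digraph" and H :: "'b pair_pre_digraph"
  proof -
    \<comment> \<open>The order of \<open>G\<close> and \<open>H\<close> is unknown while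
      \<open>coincident\<close> is oriented. Both cases give the claim by the symmetry of the
      intersection.\<close>
    have "coincident (graph_class G) (graph_class H) \<or> coincident (graph_class H) (graph_class G)"
      if "\<not> isomorphic G H" "energy G = energy H"
      using that isomorphic_iff_class[OF G H] energy_of_eq_iff[OF graph_class(1)[OF G] graph_class(1)[OF H]]
      by (auto simp: class_invariants G H)
    then show ?thesis
      using coincident_differ[of "graph_class G" "graph_class H"] coincident_differ[of "graph_class H" "graph_class G"]
      by (auto simp: class_invariants G H Let_def inf_commute)
  qed
  ultimately show ?thesis using P unique by simp
qed

end
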